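(* Let $H,K,U$, $A,B,R,Q,Q_T,\overline Q,\overline Q_T,S,S_T,\sigma$ and $z_0\in H$ be as in the context, and let $M\ge1$, $\omega\in\mathbb R$ be such that $\|e^{tA}\|_{\mathcal L(H)},\|e^{tA^*}\|_{\mathcal L(H)}\le Me^{\omega t}$ for all $t\ge0$. Put $$C_{BR}=\|BR^{-1}B^*\|_{\mathcal L(H)},\quad C_{\overline Q_TS_T}=\|\overline Q_TS_T\|_{\mathcal L(H)},\quad C_{\overline QS}=\|\overline QS\|_{\mathcal L(H)}.$$ Let $T>0$ be such that $$M^2\big(C_{\overline Q_TS_T}+C_{\overline QS}\,T\big)\,T\,C_{BR}\,e^{2Me^{\omega T}C_{BR}\beta T+2\omega T}<1,$$ where $$\beta=M^2e^{2\omega T}\big(\|Q_T+\overline Q_T\|_{\mathcal L(H)}+T\|Q+\overline Q\|_{\mathcal L(H)}\big).$$ Then the LQM mild solution to the mean field game with horizon $T$ is unique.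
   Context: $H,K,U$ are separable real Hilbert spaces. $\mathcal L(\cdot;\cdot)$ denotes bounded linear operators with the operator norm, $\mathcal L(H)=\mathcal L(H;H)$; $\Sigma(H)$ is the set of self-adjoint operators in $\mathcal L(H)$, $\Sigma^+(H)$ the set of nonnegative ones in $\Sigma(H)$ (similarly for $U$). Standing assumptions: $A:D(A)\subset H\to H$ is closed, densely defined and generates a $C_0$-semigroup $(e^{tA})_{t\ge0}$ on $H$; $B\in\mathcal L(U;H)$; $Q,Q_T\in\Sigma^+(H)$; $\overline Q,\overline Q_T\in\Sigma(H)$; $Q+\overline Q,\ Q_T+\overline Q_T\in\Sigma^+(H)$; $R\in\Sigma(U)$ with $\langle R\alpha,\alpha\rangle_U\ge\varepsilon|\alpha|_U^2$ for all $\alpha\in U$ and some $\varepsilon>0$; $S,S_T\in\mathcal L(H)$; $\sigma\in\mathcal L(K;H)$; $z_0\in H$ (the mean $z_0=\int_H x\,m_0(dx)$ of the initial distribution $m_0$ of the agents). (The subscript $T$ in $Q_T,\overline Q_T,S_T$ is only a label for the terminal-cost operators.) $C_s([0,T];\Sigma^+(H))$ is the space of strongly continuous maps $f:[0,T]\to\Sigma^+(H)$, i.e. $t\mapsto f(t)x$ is continuous for each $x\in H$. LQM (Linear-Quadratic-Mean) mild solution to the mean field game: a 4-tuple $(P,r,z,s)\in C_s([0,T];\Sigma^+(H))\times C([0,T];H)\times C([0,T];H)\times C([0,T];\mathbb R)$ such that, for all $x\in H$ and $t\in[0,T]$, $$P(t)x=e^{(T-t)A^*}(Q_T+\overline Q_T)e^{(T-t)A}x+\int_t^Te^{(s-t)A^*}(Q+\overline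 Q)e^{(s-t)A}x\,ds-\int_t^Te^{(s-t)A^*}P(s)BR^{-1}B^*P(s)e^{(s-t)A}x\,ds$$ (it is known that there is exactly one such $P$); $$z(t)=e^{tA}z_0-\int_0^te^{(t-s)A}BR^{-1}B^*P(s)z(s)\,ds-\int_0^te^{(t-s)A}BR^{-1}B^*r(s)\,ds,$$ $$r(t)=-e^{(T-t)A^*}\overline Q_TS_Tz(T)-\int_t^Te^{(s-t)A^*}P(s)BR^{-1}B^*r(s)\,ds-\int_t^Te^{(s-t)A^*}\overline QSz(s)\,ds;$$ and $$s(t)=\tfrac12\langle\overline Q_TS_Tz(T),S_Tz(T)\rangle_H+\int_t^T\Big[\tfrac12\mathrm{Tr}[\sigma\sigma^*P(u)]-\tfrac12\langle BR^{-1}B^*r(u),r(u)\rangle_H+\tfrac12\langle\overline QSz(u),Sz(u)\rangle_H\Big]du .$$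
   Formalization: The growth exponent ω is assumed nonnegative; for ω<0 the claim as printed is false (e.g. H=K=U=ℝ, T=1, A=ω=−3π/4, B=R=Q=1, Q̄=−1, S=−9π²/8, other data 0). If ω<0 satisfies the growth bounds, so does 0, and the result applies with ω=0. *)

theory Defs
  imports "HOL-Analysis.Analysis"
begin

subsection \<open>Bounded operators on Hilbert spaces\<close>

text \<open>
  A separable real Hilbert space is a type of sort \<open>{real_inner, banach, second_countable_topology}\<close>.
\<close>

text \<open>
  On a Hilbert space the following two operations are meaningful (Riesz; bounded inverse theorem):
  the library adjoint of a bounded operator is bounded, and so is the inverse of a bijective one.
\<close>

definition adj :: "('a::real_inner \<Rightarrow>\<^sub>L 'b::real_inner) \<Rightarrow> ('b \<Rightarrow>\<^sub>L 'a)" where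
  "adj B = Blinfun (adjoint (blinfun_apply B))"

definition blinfun_inv :: "('a::real_normed_vector \<Rightarrow>\<^sub>L 'b::real_normed_vector) \<Rightarrow> ('b \<Rightarrow>\<^sub>L 'a)" where
  "blinfun_inv R = Blinfun (inv (blinfun_apply R))"

definition Sigma_sa :: "('a::real_inner \<Rightarrow>\<^sub>L 'a) set" where
  "Sigma_sa = {P :: 'a \<Rightarrow>\<^sub>L 'a. \<forall>x y. P x \<bullet> y = x \<bullet> P y}"

definition Sigma_plus :: "('a::real_inner \<Rightarrow>\<^sub>L 'a) set" where
  "Sigma_plus = {P \<in> Sigma_sa. \<forall>x. 0 \<le> P x \<bullet> x}"

subsection \<open>Trace\<close>

definition orthonormal_basis :: "'a::real_inner set \<Rightarrow> bool" where
  "orthonormal_basis E \<longleftrightarrow>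
     pairwise orthogonal E \<and> (\<forall>e\<in>E. norm e = 1) \<and> closure (span E) = UNIV"

definition trace_class :: "('a::real_inner \<Rightarrow>\<^sub>L 'a) \<Rightarrow> bool" where
  "trace_class L \<longleftrightarrow> (\<exists>a b :: nat \<Rightarrow> 'a.
     summable (\<lambda>k. norm (a k) * norm (b k)) \<and> (\<forall>x. (\<lambda>k. (b k \<bullet> x) *\<^sub>R a k) sums L x))"

text \<open>
  For a trace class operator the sum below does not depend on the orthonormal basis, so that the
  description is proper.  The sum is over the unordered basis, which covers finite and infinite
  dimension alike.
\<close>

definition Tr :: "('a::real_inner \<Rightarrow>\<^sub>L 'a) \<Rightarrow> real" where
  "Tr L = (THE c. \<forall>E. orthonormal_basis E \<longrightarrow> ((\<lambda>e. L e \<bullet> e) has_sum c) E)"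

subsection \<open>Unbounded operators and semigroups\<close>

text \<open>
  An unbounded operator is a pair of a domain \<open>D\<close> and a total function \<open>A\<close>, of which only the
  values on \<open>D\<close> matter.  A semigroup is a function of a real argument, of which only the values at
  nonnegative arguments matter.
\<close>

definition linear_operator_on :: "'a::real_vector set \<Rightarrow> ('a \<Rightarrow> 'a) \<Rightarrow> bool" where
  "linear_operator_on D A \<longleftrightarrow> subspace D \<and>
     (\<forall>x\<in>D. \<forall>y\<in>D. A (x + y) = A x + A y) \<and> (\<forall>c. \<forall>x\<in>D. A (c *\<^sub>R x) = c *\<^sub>R A x)"

definition closed_operator :: "'a::real_normed_vector set \<Rightarrow> ('a \<Rightarrow> 'a) \<Rightarrow> bool" where
  "closed_operator D A \<longleftrightarrow> linear_operator_on D A \<and> closed ((\<lambda>x. (x, A x)) ` D)"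

definition adj_dom :: "'a::real_inner set \<Rightarrow> ('a \<Rightarrow> 'a) \<Rightarrow> 'a set" where
  "adj_dom D A = {y. \<exists>w. \<forall>x\<in>D. A x \<bullet> y = x \<bullet> w}"

definition adj_op :: "'a::real_inner set \<Rightarrow> ('a \<Rightarrow> 'a) \<Rightarrow> 'a \<Rightarrow> 'a" where
  "adj_op D A y = (THE w. \<forall>x\<in>D. A x \<bullet> y = x \<bullet> w)"

definition C0_semigroup :: "(real \<Rightarrow> ('a::real_normed_vector \<Rightarrow>\<^sub>L 'a)) \<Rightarrow> bool" where
  "C0_semigroup E \<longleftrightarrow> E 0 = id_blinfun \<and>
     (\<forall>s\<ge>0. \<forall>t\<ge>0. E (s + t) = E s o\<^sub>L E t) \<and>
     (\<forall>x. ((\<lambda>t. E t x) \<longlongrightarrow> x) (at_right 0))"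

definition generates ::
  "'a::real_normed_vector set \<Rightarrow> ('a \<Rightarrow> 'a) \<Rightarrow> (real \<Rightarrow> ('a \<Rightarrow>\<^sub>L 'a)) \<Rightarrow> bool" where
  "generates D A E \<longleftrightarrow> C0_semigroup E \<and>
     D = {x. \<exists>y. ((\<lambda>t. (E t x - x) /\<^sub>R t) \<longlongrightarrow> y) (at_right 0)} \<and>
     (\<forall>x\<in>D. ((\<lambda>t. (E t x - x) /\<^sub>R t) \<longlongrightarrow> A x) (at_right 0))"

subsection \<open>LQM mild solutions\<close>

definition Cs :: "real \<Rightarrow> (real \<Rightarrow> ('a::real_inner \<Rightarrow>\<^sub>L 'a)) set" where
  "Cs T = {P. (\<forall>t\<in>{0..T}. P t \<in> Sigma_plus) \<and> (\<forall>x. continuous_on {0..T} (\<lambda>t. P t x))}"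

definition BRB :: "('u::real_inner \<Rightarrow>\<^sub>L 'h::real_inner) \<Rightarrow> ('u \<Rightarrow>\<^sub>L 'u) \<Rightarrow> ('h \<Rightarrow>\<^sub>L 'h)" where
  "BRB B R = B o\<^sub>L blinfun_inv R o\<^sub>L adj B"

text \<open>
  \<open>EA t\<close> and \<open>EAs t\<close> stand for the semigroups generated by \<open>A\<close> and by its adjoint; \<open>Qb\<close>, \<open>QbT\<close> are
  the barred operators.  All integrands are continuous, except possibly the trace term: its being
  defined and integrable is part of the last equation, hence the two conditions that precede it.
\<close>

definition LQM_mild_solution ::
  "(real \<Rightarrow> ('h::{real_inner, banach, second_countable_topology} \<Rightarrow>\<^sub>L 'h)) \<Rightarrow>
   (real \<Rightarrow> ('h \<Rightarrow>\<^sub>L 'h)) \<Rightarrow>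
   ('u::{real_inner, banach, second_countable_topology} \<Rightarrow>\<^sub>L 'h) \<Rightarrow> ('u \<Rightarrow>\<^sub>L 'u) \<Rightarrow>
   ('h \<Rightarrow>\<^sub>L 'h) \<Rightarrow> ('h \<Rightarrow>\<^sub>L 'h) \<Rightarrow> ('h \<Rightarrow>\<^sub>L 'h) \<Rightarrow> ('h \<Rightarrow>\<^sub>L 'h) \<Rightarrow>
   ('h \<Rightarrow>\<^sub>L 'h) \<Rightarrow> ('h \<Rightarrow>\<^sub>L 'h) \<Rightarrow>
   ('k::{real_inner, banach, second_countable_topology} \<Rightarrow>\<^sub>L 'h) \<Rightarrow> 'h \<Rightarrow> real \<Rightarrow>
   (real \<Rightarrow> ('h \<Rightarrow>\<^sub>L 'h)) \<Rightarrow> (real \<Rightarrow> 'h) \<Rightarrow> (real \<Rightarrow> 'h) \<Rightarrow> (real \<Rightarrow> real) \<Rightarrow> bool" where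
  "LQM_mild_solution EA EAs B R Q QT Qb QbT S ST \<sigma> z0 T P r z s \<longleftrightarrow>
     P \<in> Cs T \<and> continuous_on {0..T} r \<and> continuous_on {0..T} z \<and> continuous_on {0..T} s \<and>
     (\<forall>t\<in>{0..T}. \<forall>x. P t x =
        EAs (T - t) ((QT + QbT) (EA (T - t) x))
        + (LINT u:{t..T}|lborel. EAs (u - t) ((Q + Qb) (EA (u - t) x)))
        - (LINT u:{t..T}|lborel. EAs (u - t) (P u (BRB B R (P u (EA (u - t) x)))))) \<and>
     (\<forall>t\<in>{0..T}. z t =
        EA t z0
        - (LINT u:{0..t}|lborel. EA (t - u) (BRB B R (P u (z u))))
        - (LINT u:{0..t}|lborel. EA (t - u) (BRB B R (r u)))) \<and>
     (\<forall>t\<in>{0..T}. r t =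
        - EAs (T - t) (QbT (ST (z T)))
        - (LINT u:{t..T}|lborel. EAs (u - t) (P u (BRB B R (r u))))
        - (LINT u:{t..T}|lborel. EAs (u - t) (Qb (S (z u))))) \<and>
     (AE u\<in>{0..T} in lborel. trace_class (\<sigma> o\<^sub>L adj \<sigma> o\<^sub>L P u)) \<and>
     set_integrable lborel {0..T} (\<lambda>u. Tr (\<sigma> o\<^sub>L adj \<sigma> o\<^sub>L P u)) \<and>
     (\<forall>t\<in>{0..T}. s t =
        1/2 * (QbT (ST (z T)) \<bullet> ST (z T))
        + (LINT u:{t..T}|lborel. 1/2 * Tr (\<sigma> o\<^sub>L adj \<sigma> o\<^sub>L P u)
             - 1/2 * (BRB B R (r u) \<bullet> r u) + 1/2 * (Qb (S (z u)) \<bullet> S (z u))))"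

end

theory Submission
  imports Defs
begin

text \<open>
  The system is triangular: the Riccati equation contains \<open>P\<close> alone, the equations of \<open>z\<close> and \<open>r\<close> are
  linear once \<open>P\<close> is known, and \<open>s\<close> is given explicitly by the other three.

  For \<open>P\<close>, the key is the a priori bound \<open>norm (P t) \<le> \<beta>\<close> (\<open>riccati_norm_le\<close>).  The quadratic form of the
  nonlinear term \<open>P G P\<close>, where \<open>G = B R\<inverse> B\<^sup>*\<close>, is nonnegative and enters with a minus sign, so the form of \<open>P t\<close> is
  bounded by that of the linear data.  This uses that \<open>R\<inverse>\<close>, hence \<open>G\<close>, is a nonnegative bounded
  operator (\<open>BRB_nonneg\<close>), and that the semigroup generated by the adjoint of \<open>A\<close> consists of the
  adjoints of the semigroup of \<open>A\<close> (\<open>semigroup_adjoint\<close>).  On a set of bounded operators the quadratic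
  nonlinearity is Lipschitz, and Gronwall's lemma gives uniqueness (\<open>riccati_unique\<close>).

  For \<open>z\<close> and \<open>r\<close>, the differences of two solutions solve the homogeneous forward-backward system.  The
  forward equation bounds \<open>z\<close> by \<open>r\<close> and the backward equation bounds \<open>r\<close> by \<open>z\<close>; both constants come
  from Gronwall's lemma with the bound \<open>\<beta>\<close>.  Their product is exactly the quantity assumed to be less
  than \<open>1\<close>, so both differences vanish (\<open>forward_backward_zero\<close>).
\<close>

section \<open>Coercive operators, adjoints and inverses\<close>

text \<open>
  The solution minimises the energy \<open>R x \<bullet> x / 2 - f x\<close>.  By coercivity the energy is bounded below, and
  by the parallelogram identity every minimising sequence is Cauchy.  For \<open>R = id\<close> this is the Riesz
  representation theorem, which makes adjoints exist; for \<open>f = (\<bullet>) c\<close> it gives surjectivity of a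
  coercive \<open>R\<close>.
\<close>

lemma coercive_representation:
  fixes R :: "'a::{real_inner, banach} \<Rightarrow>\<^sub>L 'a" and f :: "'a \<Rightarrow> real"
  assumes R: "R \<in> Sigma_sa" and e: "0 < e" and co: "\<And>x. e * (norm x)\<^sup>2 \<le> R x \<bullet> x"
    and f: "bounded_linear f"
  shows "\<exists>x. \<forall>y. R x \<bullet> y = f y"
proof -
  interpret f: bounded_linear f by fact
  define J where "J x = R x \<bullet> x / 2 - f x" for x
  have sym: "R x \<bullet> y = x \<bullet> R y" for x y using R by (auto simp: Sigma_sa_def)
  \<comment> \<open>The parallelogram identity: it bounds the distance of two points by their energy excess.\<close>
  have mid: "J ((1/2) *\<^sub>R (x + y)) = (J x + J y) / 2 - R (x - y) \<bullet> (x - y) / 8" for x y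
    using sym[of x y] 
    by (simp add: J_def blinfun.add_right blinfun.scaleR_right blinfun.diff_right f.add f.scaleR
        inner_add_left inner_add_right inner_diff_left inner_diff_right inner_commute field_simps)
  obtain C where C: "C > 0" "\<And>x. norm (f x) \<le> norm x * C" using f.pos_bounded by auto
  have low: "- (C\<^sup>2 / (2 * e)) \<le> J x" for x
  proof -
    have "f x \<le> norm x * C" using C(2)[of x] by auto
    moreover have "0 \<le> (e * norm x - C)\<^sup>2" by simp
    then have "0 \<le> (e * norm x - C)\<^sup>2 / (2 * e)" using e by simp
    then have "0 \<le> e * (norm x)\<^sup>2 / 2 - norm x * C + C\<^sup>2 / (2 * e)"
      using e by (simp add: power2_eq_square field_simps)
    ultimately show ?thesis using co[of x] by (simp add: J_def)
  qed
  define m where "m = Inf (range J)"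
  have bdd: "bdd_below (range J)" using low by (intro bdd_belowI) auto
  have mle: "m \<le> J x" for x unfolding m_def by (rule cInf_lower) (use bdd in auto)
  have "\<exists>x. J x < m + inverse (real (Suc n))" for n
    using cInf_lessD[of "range J" "m + inverse (real (Suc n))"] unfolding m_def by auto
  then obtain X where X: "\<And>n. J (X n) < m + inverse (real (Suc n))" by metis
  have dist: "e / 8 * (norm (X i - X j))\<^sup>2 \<le> (inverse (real (Suc i)) + inverse (real (Suc j))) / 2" for i j
  proof -
    have "m \<le> (J (X i) + J (X j)) / 2 - R (X i - X j) \<bullet> (X i - X j) / 8"
      using mid[of "X i" "X j"] mle[of "(1/2) *\<^sub>R (X i + X j)"] by metis
    then show ?thesis using X[of i] X[of j] co[of "X i - X j"] by argo
  qed
  have "Cauchy X"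
  proof (rule metric_CauchyI)
    fix r :: real assume r: "0 < r"
    then have "0 < e * r\<^sup>2 / 8" using e by simp
    then obtain N where N: "inverse (real (Suc N)) < e * r\<^sup>2 / 8" using reals_Archimedean by blast
    show "\<exists>N. \<forall>i\<ge>N. \<forall>j\<ge>N. dist (X i) (X j) < r"
    proof (intro exI allI impI)
      fix i j assume "N \<le> i" "N \<le> j"
      then have "inverse (real (Suc i)) \<le> inverse (real (Suc N))" "inverse (real (Suc j)) \<le> inverse (real (Suc N))"
        by (auto intro!: le_imp_inverse_le)
      then have "e / 8 * (norm (X i - X j))\<^sup>2 < e / 8 * r\<^sup>2" using dist[of i j] N by argo
      then have "(norm (X i - X j))\<^sup>2 < r\<^sup>2" using e by simp
      then have "norm (X i - X j) < r" by (rule power_less_imp_less_base) (use r in simp)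
      then show "dist (X i) (X j) < r" by (simp add: dist_norm)
    qed
  qed
  then obtain x where x: "X \<longlonglongrightarrow> x" using Cauchy_convergent convergent_def by blast
  have "(\<lambda>n. J (X n)) \<longlonglongrightarrow> J x" unfolding J_def by (intro tendsto_intros x f.tendsto) simp
  moreover have "(\<lambda>n. m + inverse (real (Suc n))) \<longlonglongrightarrow> m + 0"
    by (intro tendsto_intros LIMSEQ_inverse_real_of_nat)
  ultimately have "J x \<le> m + 0" by (rule LIMSEQ_le) (use X less_imp_le in blast)
  then have min: "J x \<le> J y" for y using mle[of y] by simp
  have "R x \<bullet> y = f y" for y
  proof -
    define d where "d = R x \<bullet> y - f y"
    define q where "q = R y \<bullet> y"
    have "0 \<le> e * (norm y)\<^sup>2" using e by simp
    then have q: "0 \<le> q" unfolding q_def using co[of y] by linarith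
    have Jt: "J (x + t *\<^sub>R y) = J x + t * d + t\<^sup>2 * q / 2" for t
      using sym[of x y]
      by (simp add: J_def d_def q_def blinfun.add_right blinfun.scaleR_right f.add f.scaleR inner_commute
        inner_add_left inner_add_right power2_eq_square field_simps)
    have *: "0 \<le> t * d + t\<^sup>2 * q / 2" for t
      using min[of "x + t *\<^sub>R y"] unfolding Jt by linarith
    \<comment> \<open>The step \<open>t = - p\<close> decreases the energy strictly unless \<open>d = 0\<close>.\<close>
    define p where "p = d / (q + 1)"
    have d: "d = p * (q + 1)" using q by (simp add: p_def)
    have "0 \<le> - (p\<^sup>2 * (q / 2 + 1))"
      using *[of "- p"] unfolding d by (simp add: field_simps power2_eq_square)
    then have "p\<^sup>2 * (q / 2 + 1) \<le> 0" by simp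
    then have "p = 0" using q by (simp add: mult_le_0_iff)
    then have "d = 0" by (simp add: d)
    then show ?thesis by (simp add: d_def)
  qed
  then show ?thesis by blast
qed

text \<open>
  The adjoint is defined by a choice, wrapped in a coercion to bounded operators.  Riesz representation
  shows that the choice succeeds, and Cauchy--Schwarz that its result is bounded.
\<close>

lemma adjoint_inner:
  fixes B :: "'a::{real_inner, banach} \<Rightarrow>\<^sub>L 'b::real_inner"
  shows "x \<bullet> adj B y = B x \<bullet> y"
proof -
  have "\<exists>z. \<forall>x. B x \<bullet> y = x \<bullet> z" for y
  proof -
    have "bounded_linear (\<lambda>x. B x \<bullet> y)" by (intro bounded_linear_intros)
    then obtain z where "\<forall>x. id_blinfun z \<bullet> x = B x \<bullet> y"
      using coercive_representation[of id_blinfun 1 "\<lambda>x. B x \<bullet> y"]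
      by (auto simp: Sigma_sa_def power2_norm_eq_inner)
    then have "\<forall>x. B x \<bullet> y = x \<bullet> z" by (simp add: inner_commute)
    then show ?thesis by blast
  qed
  then have "\<exists>f'. \<forall>y x. B x \<bullet> y = x \<bullet> f' y" by (intro choice allI)
  then have "\<exists>f'. \<forall>x y. B x \<bullet> y = x \<bullet> f' y" by blast
  then have *: "B x \<bullet> y = x \<bullet> adjoint B y" for x y
    unfolding adjoint_def by (rule someI2_ex) auto
  have "bounded_linear (adjoint B)"
  proof (rule bounded_linear_intro)
    show "adjoint B (x + y) = adjoint B x + adjoint B y" for x y
      by (simp add: vector_eq_ldot[symmetric] inner_add_right flip: *)
    show "adjoint B (r *\<^sub>R x) = r *\<^sub>R adjoint B x" for x r
      by (simp add: vector_eq_ldot[symmetric] flip: *)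
    show "norm (adjoint B y) \<le> norm y * norm B" for y
    proof (cases "adjoint B y = 0")
      case False
      have "norm (adjoint B y) * norm (adjoint B y) = B (adjoint B y) \<bullet> y"
        by (simp add: * power2_norm_eq_inner flip: power2_eq_square)
      also have "\<dots> \<le> norm (B (adjoint B y)) * norm y" by (rule norm_cauchy_schwarz)
      also have "\<dots> \<le> norm B * norm (adjoint B y) * norm y"
        by (intro mult_right_mono norm_blinfun) auto
      finally show ?thesis using False by (simp add: mult_ac)
    qed auto
  qed
  then show ?thesis by (simp add: adj_def bounded_linear_Blinfun_apply *)
qed

text \<open>
  Coercivity gives the lower bound \<open>e * norm x \<le> norm (R x)\<close>, hence injectivity and the bound \<open>1 / e\<close> for
  the inverse.
\<close>

lemma coercive_inverse:
  fixes R :: "'a::{real_inner, banach} \<Rightarrow>\<^sub>L 'a"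
  assumes R: "R \<in> Sigma_sa" and e: "0 < e" and co: "\<And>x. e * (norm x)\<^sup>2 \<le> R x \<bullet> x"
  shows "R (blinfun_inv R x) = x"
proof -
  have "\<exists>x. R x = c" for c
  proof -
    obtain x where "\<forall>y. R x \<bullet> y = c \<bullet> y"
      using coercive_representation[OF assms, of "\<lambda>y. c \<bullet> y"] bounded_linear_inner_right by auto
    then show ?thesis by (meson vector_eq_rdot)
  qed
  then have "surj R" by (metis surjI)
  then have inv: "R (inv R y) = y" for y by (rule surj_f_inv_f)
  have low: "e * norm x \<le> norm (R x)" for x
  proof (cases "x = 0")
    case False
    have "e * norm x * norm x \<le> R x \<bullet> x" using co[of x] by (simp add: power2_eq_square)
    also have "\<dots> \<le> norm (R x) * norm x" by (rule norm_cauchy_schwarz)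
    finally show ?thesis using False by simp
  qed auto
  have inj: "x = y" if "R x = R y" for x y
    using low[of "x - y"] that e by (simp add: blinfun.diff_right mult_le_0_iff)
  have "bounded_linear (inv R)"
  proof (rule bounded_linear_intro)
    show "inv R (x + y) = inv R x + inv R y" for x y
      by (rule inj) (simp add: inv blinfun.add_right)
    show "inv R (r *\<^sub>R x) = r *\<^sub>R inv R x" for x r
      by (rule inj) (simp add: inv blinfun.scaleR_right)
    show "norm (inv R y) \<le> norm y * (1 / e)" for y
      using low[of "inv R y"] e by (simp add: inv field_simps)
  qed
  then show ?thesis by (simp add: blinfun_inv_def bounded_linear_Blinfun_apply inv)
qed

text \<open>
  With \<open>v = R\<inverse> B\<^sup>* x\<close> the form is \<open>R v \<bullet> v\<close>.  This sign is what makes the quadratic term of the Riccati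
  equation harmless in \<open>riccati_norm_le\<close> below.
\<close>

lemma BRB_nonneg:
  fixes B :: "'u::{real_inner, banach} \<Rightarrow>\<^sub>L 'h::real_inner"
  assumes R: "R \<in> Sigma_sa" and e: "0 < e" and co: "\<And>x. e * (norm x)\<^sup>2 \<le> R x \<bullet> x"
  shows "0 \<le> BRB B R x \<bullet> x"
proof -
  define v where "v = blinfun_inv R (adj B x)"
  have "BRB B R x \<bullet> x = v \<bullet> adj B x" by (simp add: BRB_def v_def adjoint_inner)
  also have "\<dots> = R v \<bullet> v" by (simp add: v_def coercive_inverse[OF assms] inner_commute)
  finally show ?thesis using co[of v] e by (smt (verit) mult_nonneg_nonneg zero_le_power2)
qed

section \<open>Strongly continuous semigroups and their adjoints\<close>

lemma semigroup_continuous_on: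
  assumes E: "C0_semigroup E" and bd: "\<And>t. t \<in> {0..T} \<Longrightarrow> norm (E t) \<le> N"
  shows "continuous_on {0..T} (\<lambda>t. E t x)"
proof -
  have key: "norm (E t x - E s x) \<le> N * norm (E (t - s) x - x)" if "0 \<le> s" "s \<le> t" "t \<le> T" for s t
  proof -
    have "E (s + (t - s)) = E s o\<^sub>L E (t - s)" using E that unfolding C0_semigroup_def by (metis diff_ge_0_iff_ge)
    then have "E t x - E s x = E s (E (t - s) x - x)" by (simp add: blinfun.diff_right)
    also have "norm \<dots> \<le> norm (E s) * norm (E (t - s) x - x)" by (rule norm_blinfun)
    also have "\<dots> \<le> N * norm (E (t - s) x - x)" using that by (intro mult_right_mono bd) auto
    finally show ?thesis .
  qed
  show ?thesis
  proof (cases "0 \<le> T")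
    case True
    then have N: "0 \<le> N" using order_trans[OF norm_ge_zero bd[of 0]] by simp
    have lim: "((\<lambda>t. E t x) \<longlongrightarrow> x) (at_right 0)" and E0: "E 0 x = x"
      using E unfolding C0_semigroup_def by auto
    show ?thesis unfolding continuous_on_iff
    proof (intro ballI allI impI)
      fix s e :: real assume s: "s \<in> {0..T}" and e: "0 < e"
      have "\<forall>\<^sub>F h in at_right 0. dist (E h x) x < e / (N + 1)"
        using lim e N by (intro tendstoD) auto
      then obtain d where d: "d > 0" "\<And>h. 0 < h \<Longrightarrow> h < d \<Longrightarrow> dist (E h x) x < e / (N + 1)"
        unfolding eventually_at_right[OF zero_less_one] by auto
      have d': "dist (E h x) x < e / (N + 1)" if "0 \<le> h" "h < d" for h
        using d(2)[of h] that e N by (cases "h = 0") (auto simp: E0)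
      have "dist (E t x) (E s x) < e" if t: "t \<in> {0..T}" "dist t s < d" for t
      proof -
        have "norm (E t x - E s x) \<le> N * norm (E \<bar>t - s\<bar> x - x)"
          using key[of s t] key[of t s] s t by (cases "s \<le> t") (auto simp: norm_minus_commute)
        also have "\<dots> \<le> N * (e / (N + 1))" 
          using d'[of "\<bar>t - s\<bar>"] t N by (intro mult_left_mono) (auto simp: dist_norm)
        also have "\<dots> < e" using e N by (simp add: field_simps)
        finally show ?thesis by (simp add: dist_norm)
      qed
      then show "\<exists>d>0. \<forall>t\<in>{0..T}. dist t s < d \<longrightarrow> dist (E t x) (E s x) < e" using d(1) by blast
    qed
  qed auto
qed

text \<open>
  The averages \<open>(1/h) \<integral>\<^sub>0\<^sup>h E s x ds\<close> converge to \<open>x\<close> as \<open>h\<close> tends to \<open>0\<close> and lie in the domain of the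
  generator, because applying \<open>E t\<close> only shifts the interval of integration.
\<close>

lemma generator_domain_dense:
  fixes E :: "real \<Rightarrow> ('a::banach \<Rightarrow>\<^sub>L 'a)"
  assumes gen: "generates D A E" and bd: "\<And>t. t \<in> {0..1} \<Longrightarrow> norm (E t) \<le> N"
  shows "closure D = UNIV"
proof -
  have E: "C0_semigroup E" and D: "D = {x. \<exists>y. ((\<lambda>t. (E t x - x) /\<^sub>R t) \<longlongrightarrow> y) (at_right 0)}"
    using gen unfolding generates_def by auto
  have E0: "E 0 x = x" and Eadd: "0 \<le> s \<Longrightarrow> 0 \<le> t \<Longrightarrow> E (s + t) x = E s (E t x)" for x s t
    using E unfolding C0_semigroup_def by auto
  have "x \<in> closure D" for x
  proof -
    note cont = semigroup_continuous_on[OF E bd, of 1 x]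
    define F where "F u = integral {0..u} (\<lambda>t. E t x)" for u
    have int: "(\<lambda>t. E t x) integrable_on {a..b}" if "0 \<le> a" "b \<le> 1" for a b
      using that by (intro integrable_continuous_real continuous_on_subset[OF cont]) auto
    have der: "((\<lambda>t. (F (h + t) - F h) /\<^sub>R t) \<longlongrightarrow> E h x) (at_right 0)" if h: "0 \<le> h" "h < 1" for h
    proof -
      have "(F has_vector_derivative E h x) (at h within {0..1})"
        unfolding F_def using h by (intro integral_has_vector_derivative cont) auto
      then have "(F has_vector_derivative E h x) (at h within {h..1})"
        by (rule has_vector_derivative_within_subset) (use h in auto)
      then have "((\<lambda>y. (1 / norm (y - h)) *\<^sub>R (F y - (F h + (y - h) *\<^sub>R E h x))) \<longlongrightarrow> 0) (at_right h)"
        using h by (simp add: has_vector_derivative_def has_derivative_within at_within_Icc_at_right)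
      then have "((\<lambda>t. (1 / norm t) *\<^sub>R (F (h + t) - (F h + t *\<^sub>R E h x))) \<longlongrightarrow> 0) (at_right 0)"
        by (simp add: filterlim_at_right_to_0[of _ _ h] add.commute)
      moreover have "\<forall>\<^sub>F t in at_right 0. (1 / norm t) *\<^sub>R (F (h + t) - (F h + t *\<^sub>R E h x))
          = (F (h + t) - F h) /\<^sub>R t - E h x"
        using eventually_at_right_less[of 0]
        by eventually_elim (simp add: scaleR_diff_right scaleR_add_right divide_inverse)
      ultimately have "((\<lambda>t. (F (h + t) - F h) /\<^sub>R t - E h x) \<longlongrightarrow> 0) (at_right 0)"
        by (rule Lim_transform_eventually)
      then show ?thesis by (simp add: LIM_zero_iff)
    qed
    have inD: "F h /\<^sub>R h \<in> D" if h: "0 < h" "h < 1" for h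
    proof -
      have step: "E t (F h) - F h = (F (h + t) - F h) - (F (0 + t) - F 0)" if t: "0 < t" "t < 1 - h" for t
      proof -
        have "E t (F h) = integral {0..h} (\<lambda>u. E t (E u x))"
          unfolding F_def using int[of 0 h] h
          by (subst integral_linear[OF _ blinfun.bounded_linear_right, symmetric]) (auto simp: o_def)
        also have "\<dots> = integral {0..h} ((\<lambda>u. E u x) \<circ> (+) t)"
          using t by (intro integral_cong) (simp add: Eadd)
        also have "\<dots> = integral {t..h + t} (\<lambda>u. E u x)" by (subst integral_shift_Icc_real) simp
        also have "\<dots> = F (h + t) - F t"
          unfolding F_def using Henstock_Kurzweil_Integration.integral_combine[of 0 t "h + t" "\<lambda>u. E u x"] int[of 0 "h + t"] t h
          by (simp add: eq_diff_eq add.commute)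
        finally show ?thesis by (simp add: F_def)
      qed
      have "((\<lambda>t. (F (h + t) - F h) /\<^sub>R t - (F (0 + t) - F 0) /\<^sub>R t) \<longlongrightarrow> E h x - E 0 x) (at_right 0)"
        using h by (intro tendsto_diff der) auto
      moreover have "\<forall>\<^sub>F t in at_right 0. (F (h + t) - F h) /\<^sub>R t - (F (0 + t) - F 0) /\<^sub>R t = (E t (F h) - F h) /\<^sub>R t"
      proof (rule eventually_mono)
        show "\<forall>\<^sub>F t in at_right 0. t \<in> {0<..<1 - h}" using h by (intro eventually_at_right_real) simp
      qed (use step in \<open>auto simp: scaleR_diff_right[symmetric]\<close>)
      ultimately have "((\<lambda>t. (E t (F h) - F h) /\<^sub>R t) \<longlongrightarrow> E h x - E 0 x) (at_right 0)"
        by (rule Lim_transform_eventually)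
      then have "((\<lambda>t. inverse h *\<^sub>R ((E t (F h) - F h) /\<^sub>R t)) \<longlongrightarrow> inverse h *\<^sub>R (E h x - E 0 x)) (at_right 0)"
        by (intro tendsto_intros)
      then show ?thesis unfolding D
        by (auto simp: blinfun.scaleR_right scaleR_diff_right mult.commute intro!: exI[of _ "(E h x - E 0 x) /\<^sub>R h"])
    qed
    have "((\<lambda>t. F t /\<^sub>R t) \<longlongrightarrow> x) (at_right 0)" using der[of 0] by (simp add: F_def E0)
    moreover have "\<forall>\<^sub>F t in at_right 0. F t /\<^sub>R t \<in> closure D"
      using eventually_at_right_real[of 0 1] closure_subset
      by (auto elim!: eventually_mono intro: inD[THEN subsetD[OF closure_subset]])
    ultimately show ?thesis by (intro Lim_in_closed_set[OF closed_closure]) auto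
  qed
  then show ?thesis by auto
qed

lemma generator_commutes:
  assumes gen: "generates D A E" and x: "x \<in> D" and s: "0 \<le> s"
  shows "E s x \<in> D" "A (E s x) = E s (A x)"
proof -
  have E: "C0_semigroup E" and D: "D = {x. \<exists>y. ((\<lambda>t. (E t x - x) /\<^sub>R t) \<longlongrightarrow> y) (at_right 0)}"
    and lim: "\<And>x. x \<in> D \<Longrightarrow> ((\<lambda>t. (E t x - x) /\<^sub>R t) \<longlongrightarrow> A x) (at_right 0)"
    using gen unfolding generates_def by auto
  have comm: "E s (E t x) = E t (E s x)" if "0 \<le> t" for t
    using E that s unfolding C0_semigroup_def by (metis add.commute blinfun_apply_blinfun_compose)
  have "((\<lambda>t. E s ((E t x - x) /\<^sub>R t)) \<longlongrightarrow> E s (A x)) (at_right 0)"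
    by (intro tendsto_intros lim x)
  moreover have "\<forall>\<^sub>F t in at_right 0. E s ((E t x - x) /\<^sub>R t) = (E t (E s x) - E s x) /\<^sub>R t"
    using eventually_at_right_less[of 0]
    by eventually_elim (simp add: blinfun.scaleR_right blinfun.diff_right comm)
  ultimately have *: "((\<lambda>t. (E t (E s x) - E s x) /\<^sub>R t) \<longlongrightarrow> E s (A x)) (at_right 0)"
    by (rule Lim_transform_eventually)
  then show "E s x \<in> D" by (auto simp: D)
  with lim have "((\<lambda>t. (E t (E s x) - E s x) /\<^sub>R t) \<longlongrightarrow> A (E s x)) (at_right 0)" by blast
  with * show "A (E s x) = E s (A x)" by (meson tendsto_unique trivial_limit_at_right_real)
qed

text \<open>
  Strong continuity alone does not make \<open>F t (f t)\<close> continuous; the uniform bound on the operators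
  supplies the missing estimate \<open>norm (F t (f t - f s)) \<le> K * norm (f t - f s)\<close>.
\<close>

lemma strongly_continuous_apply:
  fixes F :: "'t::topological_space \<Rightarrow> 'a::real_normed_vector \<Rightarrow>\<^sub>L 'b::real_normed_vector"
  assumes F: "\<And>x. continuous_on Y (\<lambda>t. F t x)" and bd: "\<And>t. t \<in> Y \<Longrightarrow> norm (F t) \<le> K"
    and \<phi>: "continuous_on X \<phi>" "\<phi> ` X \<subseteq> Y" and f: "continuous_on X f"
  shows "continuous_on X (\<lambda>t. blinfun_apply (F (\<phi> t)) (f t))"
  unfolding continuous_on_def
proof
  fix s assume s: "s \<in> X"
  have "((\<lambda>t. K * norm (f t - f s)) \<longlongrightarrow> K * norm (f s - f s)) (at s within X)"
    using f s by (intro tendsto_intros) (simp add: continuous_on_def)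
  then have lim: "((\<lambda>t. K * norm (f t - f s)) \<longlongrightarrow> 0) (at s within X)" by simp
  have "((\<lambda>t. F (\<phi> t) (f t - f s)) \<longlongrightarrow> 0) (at s within X)"
  proof (rule Lim_null_comparison[OF _ lim])
    show "\<forall>\<^sub>F t in at s within X. norm (F (\<phi> t) (f t - f s)) \<le> K * norm (f t - f s)"
      unfolding eventually_at_filter using \<phi>(2)
      by (intro always_eventually allI impI order_trans[OF norm_blinfun] mult_right_mono bd) auto
  qed
  moreover have "((\<lambda>t. F (\<phi> t) (f s)) \<longlongrightarrow> F (\<phi> s) (f s)) (at s within X)"
    using continuous_on_compose2[OF F \<phi>] s by (simp add: continuous_on_def)
  ultimately have "((\<lambda>t. F (\<phi> t) (f t - f s) + F (\<phi> t) (f s)) \<longlongrightarrow> 0 + F (\<phi> s) (f s)) (at s within X)"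
    by (rule tendsto_add)
  then show "((\<lambda>t. F (\<phi> t) (f t)) \<longlongrightarrow> F (\<phi> s) (f s)) (at s within X)" by (simp add: blinfun.diff_right)
qed

text \<open>
  Formally \<open>EA s x \<bullet> EAs (t - s) y\<close> has derivative
  \<open>A (EA s x) \<bullet> EAs (t - s) y - EA s x \<bullet> A' (EAs (t - s) y) = 0\<close> in \<open>s\<close>.  Only one-sided derivatives
  at \<open>0\<close> are given, so the function is compared along a uniform partition of \<open>{0..t}\<close>.  Since the
  semigroups commute with their generators, each increment is at most the mesh \<open>h\<close> times an error
  that is the same for all increments and tends to \<open>0\<close> with \<open>h\<close>; the increments add up to \<open>t\<close> times
  that error.
\<close>

lemma semigroup_adjoint_on_domains:
  fixes EA EAs :: "real \<Rightarrow> ('a::real_inner \<Rightarrow>\<^sub>L 'a)"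
  assumes gA: "generates D A EA" and gA': "generates D' A' EAs"
    and dual: "\<And>x y. x \<in> D \<Longrightarrow> y \<in> D' \<Longrightarrow> A x \<bullet> y = x \<bullet> A' y"
    and bd: "\<And>s. s \<in> {0..t} \<Longrightarrow> norm (EA s) \<le> N" and bd': "\<And>s. s \<in> {0..t} \<Longrightarrow> norm (EAs s) \<le> N"
    and t: "0 \<le> t" and x: "x \<in> D" and y: "y \<in> D'"
  shows "EA t x \<bullet> y = x \<bullet> EAs t y"
proof -
  have E: "C0_semigroup EA" and E': "C0_semigroup EAs"
    and limA: "((\<lambda>h. (EA h x - x) /\<^sub>R h) \<longlongrightarrow> A x) (at_right 0)"
    and limA': "((\<lambda>h. (EAs h y - y) /\<^sub>R h) \<longlongrightarrow> A' y) (at_right 0)"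
    using gA gA' x y unfolding generates_def by auto
  have E0: "EA 0 v = v" "EAs 0 v = v" 
    and Eadd: "0 \<le> s \<Longrightarrow> 0 \<le> u \<Longrightarrow> EA (s + u) v = EA s (EA u v)"
      "0 \<le> s \<Longrightarrow> 0 \<le> u \<Longrightarrow> EAs (s + u) v = EAs s (EAs u v)" for s u v
    using E E' unfolding C0_semigroup_def by auto
  have N: "0 \<le> N" using order_trans[OF norm_ge_zero bd[of 0]] t by simp
  define e where "e h = (EA h x - x) /\<^sub>R h - A x" for h
  define e' where "e' h = (EAs h y - y) /\<^sub>R h - A' y" for h
  \<comment> \<open>The first order terms cancel by duality of \<open>A\<close> and \<open>A'\<close>; the remainders \<open>e\<close>, \<open>e'\<close> survive.\<close>
  have step: "\<bar>EA (s + h) x \<bullet> EAs u y - EA s x \<bullet> EAs (u + h) y\<bar> \<le> h * (N\<^sup>2 * (norm (e h) * norm y + norm x * norm (e' h)))"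
    if "0 \<le> s" "0 < h" "0 \<le> u" "s + h \<le> t" "u + h \<le> t" for s h u
  proof -
    have ex: "EA h x = x + h *\<^sub>R (A x + e h)" and ey: "EAs h y = y + h *\<^sub>R (A' y + e' h)"
      using that by (simp_all add: e_def e'_def)
    have "EA (s + h) x = EA s x + h *\<^sub>R (EA s (A x) + EA s (e h))"
      using that by (simp add: Eadd ex blinfun.add_right blinfun.scaleR_right)
    moreover have "EAs (u + h) y = EAs u y + h *\<^sub>R (EAs u (A' y) + EAs u (e' h))"
      using that by (simp add: Eadd ey blinfun.add_right blinfun.scaleR_right)
    moreover have "EA s (A x) \<bullet> EAs u y = EA s x \<bullet> EAs u (A' y)"
      using generator_commutes[OF gA x, of s] generator_commutes[OF gA' y, of u] that dual by metis
    ultimately have "EA (s + h) x \<bullet> EAs u y - EA s x \<bullet> EAs (u + h) y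
        = h * (EA s (e h) \<bullet> EAs u y - EA s x \<bullet> EAs u (e' h))"
      by (simp add: inner_add_left inner_add_right algebra_simps)
    moreover have bound: "\<bar>EA s v \<bullet> EAs u w\<bar> \<le> N\<^sup>2 * (norm v * norm w)" for v w
    proof -
      have "\<bar>EA s v \<bullet> EAs u w\<bar> \<le> norm (EA s v) * norm (EAs u w)" by (rule Cauchy_Schwarz_ineq2)
      also have "\<dots> \<le> (N * norm v) * (N * norm w)"
        using that N by (intro mult_mono order_trans[OF norm_blinfun] mult_right_mono bd bd') auto
      finally show ?thesis by (simp add: power2_eq_square mult_ac)
    qed
    have "\<bar>EA s (e h) \<bullet> EAs u y - EA s x \<bullet> EAs u (e' h)\<bar> \<le> N\<^sup>2 * (norm (e h) * norm y + norm x * norm (e' h))"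
      using bound[of "e h" y] bound[of x "e' h"] by (simp add: distrib_left)
    ultimately show ?thesis using that by (simp add: abs_mult)
  qed
  show ?thesis
  proof (cases "t = 0")
    case False
    define h where "h n = t / real (Suc n)" for n
    have h: "0 < h n" "real (Suc n) * h n = t" for n using False t by (auto simp: h_def)
    have bound: "\<bar>EA t x \<bullet> y - x \<bullet> EAs t y\<bar>
        \<le> t * (N\<^sup>2 * (norm (e (h n)) * norm y + norm x * norm (e' (h n))))" for n
    proof -
      define \<phi> where "\<phi> k = EA (real k * h n) x \<bullet> EAs (t - real k * h n) y" for k
      have "\<bar>\<phi> (Suc k) - \<phi> k\<bar> \<le> h n * (N\<^sup>2 * (norm (e (h n)) * norm y + norm x * norm (e' (h n))))"
        if "k < Suc n" for k
      proof -
        have "real (Suc k) * h n \<le> real (Suc n) * h n" using that h(1)[of n] by (intro mult_right_mono) auto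
        then have le: "real k * h n + h n \<le> t" using h(2)[of n] by (simp add: algebra_simps)
        have "0 \<le> real k * h n" using h(1)[of n] by simp
        then show ?thesis
          using step[of "real k * h n" "h n" "t - real (Suc k) * h n"] le h(1)[of n]
          by (simp add: \<phi>_def algebra_simps)
      qed
      then have "(\<Sum>k<Suc n. \<bar>\<phi> (Suc k) - \<phi> k\<bar>) \<le> (\<Sum>k<Suc n. h n * (N\<^sup>2 * (norm (e (h n)) * norm y + norm x * norm (e' (h n)))))"
        by (intro sum_mono) auto
      also have "\<dots> = t * (N\<^sup>2 * (norm (e (h n)) * norm y + norm x * norm (e' (h n))))"
        using h(2)[of n] by (simp del: sum.lessThan_Suc of_nat_Suc add: mult.assoc[symmetric])
      finally have "\<bar>\<phi> (Suc n) - \<phi> 0\<bar> \<le> t * (N\<^sup>2 * (norm (e (h n)) * norm y + norm x * norm (e' (h n))))"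
        using sum_abs[of "\<lambda>k. \<phi> (Suc k) - \<phi> k" "{..<Suc n}"] sum_lessThan_telescope[of \<phi> "Suc n"] by linarith
      moreover have "\<phi> (Suc n) = EA t x \<bullet> y" "\<phi> 0 = x \<bullet> EAs t y"
        unfolding \<phi>_def h(2) by (simp_all add: E0)
      ultimately show ?thesis by simp
    qed
    have "h \<longlonglongrightarrow> 0" unfolding h_def using LIMSEQ_Suc[OF lim_const_over_n[of t]] by simp
    then have hr: "filterlim h (at_right 0) sequentially"
      by (rule tendsto_imp_filterlim_at_right) (use h(1) in auto)
    have "((\<lambda>h. (EA h x - x) /\<^sub>R h - A x) \<longlongrightarrow> 0) (at_right 0)" "((\<lambda>h. (EAs h y - y) /\<^sub>R h - A' y) \<longlongrightarrow> 0) (at_right 0)"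
      using limA limA' by (simp_all add: LIM_zero)
    then have "(\<lambda>n. e (h n)) \<longlonglongrightarrow> 0" "(\<lambda>n. e' (h n)) \<longlonglongrightarrow> 0"
      unfolding e_def e'_def by (auto intro: filterlim_compose[OF _ hr])
    then have "(\<lambda>n. t * (N\<^sup>2 * (norm (e (h n)) * norm y + norm x * norm (e' (h n)))))
        \<longlonglongrightarrow> t * (N\<^sup>2 * (norm (0::'a) * norm y + norm x * norm (0::'a)))"
      by (intro tendsto_intros)
    then have "\<bar>EA t x \<bullet> y - x \<bullet> EAs t y\<bar> \<le> t * (N\<^sup>2 * (norm (0::'a) * norm y + norm x * norm (0::'a)))"
      by (rule LIMSEQ_le_const) (use bound in auto)
    then show ?thesis by simp
  qed (simp add: E0)
qed

text \<open>
  The semigroup generated by the adjoint of \<open>A\<close> consists of the adjoint operators: the identity extends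
  from the two domains by density.  Density of the domain of \<open>A\<close> also makes the description that
  defines \<open>adj_op\<close> proper.
\<close>

lemma semigroup_adjoint:
  fixes EA EAs :: "real \<Rightarrow> ('a::{real_inner, banach} \<Rightarrow>\<^sub>L 'a)"
  assumes dense: "closure D = UNIV" and gA: "generates D A EA"
    and gA': "generates (adj_dom D A) (adj_op D A) EAs"
    and bd: "\<And>s. 0 \<le> s \<Longrightarrow> norm (EA s) \<le> M * exp (\<omega> * s)"
    and bd': "\<And>s. 0 \<le> s \<Longrightarrow> norm (EAs s) \<le> M * exp (\<omega> * s)"
    and w: "0 \<le> \<omega>" and t: "0 \<le> t"
  shows "EA t x \<bullet> y = x \<bullet> EAs t y"
proof -
  have M: "0 \<le> M" using order_trans[OF norm_ge_zero bd[of 0]] by simp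
  have up: "M * exp (\<omega> * s) \<le> M * exp (\<omega> * u)" if "s \<le> u" for s u
    using that w M by (intro mult_left_mono) (auto intro: mult_left_mono)
  have b: "norm (EA s) \<le> M * exp (\<omega> * u)" "norm (EAs s) \<le> M * exp (\<omega> * u)" if "s \<in> {0..u}" for s u
    using bd[of s] bd'[of s] up[of s u] that by auto
  have eq: "w = w'" if "\<forall>x\<in>D. x \<bullet> w = x \<bullet> w'" for w w' :: 'a
  proof -
    have "closed {x. x \<bullet> (w - w') = 0}" by (intro closed_Collect_eq continuous_intros)
    moreover have "D \<subseteq> {x. x \<bullet> (w - w') = 0}" using that by (auto simp: inner_diff_right)
    ultimately have "closure D \<subseteq> {x. x \<bullet> (w - w') = 0}" by (rule closure_minimal[rotated])
    then have "(w - w') \<bullet> (w - w') = 0" using dense by blast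
    then show ?thesis by simp
  qed
  have dual: "A x \<bullet> y = x \<bullet> adj_op D A y" if x: "x \<in> D" and y: "y \<in> adj_dom D A" for x y
  proof -
    obtain w where w: "\<forall>x\<in>D. A x \<bullet> y = x \<bullet> w" using y unfolding adj_dom_def by blast
    have "adj_op D A y = w"
      unfolding adj_op_def
    proof (rule the_equality)
      show "v = w" if "\<forall>x\<in>D. A x \<bullet> y = x \<bullet> v" for v using that w by (intro eq) simp
    qed (rule w)
    then show ?thesis using w x by simp
  qed
  have dense': "closure (adj_dom D A) = UNIV"
    by (rule generator_domain_dense[OF gA' b(2)]) auto
  have 1: "EA t x \<bullet> y = x \<bullet> EAs t y" if "x \<in> D" "y \<in> adj_dom D A" for x y
    by (rule semigroup_adjoint_on_domains[OF gA gA' dual b(1) b(2) t that])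
  have 2: "EA t x \<bullet> y = x \<bullet> EAs t y" if x: "x \<in> D" for x y
  proof -
    have "closure (adj_dom D A) \<subseteq> {y. EA t x \<bullet> y = x \<bullet> EAs t y}"
      using 1 x by (intro closure_minimal closed_Collect_eq continuous_intros) auto
    then show ?thesis using dense' by blast
  qed
  have "closure D \<subseteq> {x. EA t x \<bullet> y = x \<bullet> EAs t y}"
    using 2 by (intro closure_minimal closed_Collect_eq continuous_intros) auto
  then show ?thesis using dense by blast
qed

section \<open>Gronwall's lemma\<close>

lemma norm_set_integral_le:
  fixes f :: "real \<Rightarrow> 'a::{banach, second_countable_topology}"
  assumes f: "continuous_on {a..b} f" and g: "continuous_on {a..b} g"
    and le: "\<And>u. u \<in> {a..b} \<Longrightarrow> norm (f u) \<le> g u"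
  shows "norm (LINT u:{a..b}|lborel. f u) \<le> (LINT u:{a..b}|lborel. g u)"
proof -
  note fi = borel_integrable_atLeastAtMost'[OF f] and gi = borel_integrable_atLeastAtMost'[OF g]
  have "norm (LINT u:{a..b}|lborel. f u) \<le> (LINT u:{a..b}|lborel. norm (f u))"
    by (rule set_integral_norm_bound[OF fi])
  also have "\<dots> \<le> (LINT u:{a..b}|lborel. g u)"
    using set_integrable_norm[OF fi] gi le by (rule set_integral_mono)
  finally show ?thesis .
qed

text \<open>
  The function \<open>f\<close> need not be measurable: the integral inequality is required for continuous majorants
  of \<open>f\<close> only.  This is how the norm of a difference of strongly continuous operator functions can be
  treated, as it need not be continuous.  In the applications \<open>\<tau> t\<close> is the time elapsed since the end point where the
  inequality starts, and \<open>J t\<close> is the interval of length \<open>\<tau> t\<close> between that end point and \<open>t\<close>.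

  The idea is to insert the majorant \<open>a exp (b \<tau>) + K exp (2 b \<tau>)\<close>.  The inequality then bounds \<open>f\<close>
  by the same expression with \<open>K / 2\<close> in place of \<open>K\<close>, since integrating \<open>exp (2 b \<tau>)\<close> gains the factor \<open>1 / (2 b)\<close>.
\<close>

lemma gronwall_majorants:
  fixes f \<tau> :: "real \<Rightarrow> real"
  assumes a: "0 \<le> a" and b: "0 \<le> b" and bdd: "\<And>t. t \<in> X \<Longrightarrow> f t \<le> K"
    and \<tau>: "continuous_on X \<tau>" "\<And>t. t \<in> X \<Longrightarrow> 0 \<le> \<tau> t"
    and J: "\<And>t. t \<in> X \<Longrightarrow> J t \<subseteq> X" "\<And>t. t \<in> X \<Longrightarrow> compact (J t)"
    and exp_int: "\<And>t c. t \<in> X \<Longrightarrow> 0 < c \<Longrightarrow> (LINT u:J t|lborel. exp (c * \<tau> u)) = (exp (c * \<tau> t) - 1) / c"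
    and step: "\<And>g t. continuous_on X g \<Longrightarrow> (\<And>u. u \<in> X \<Longrightarrow> f u \<le> g u) \<Longrightarrow> t \<in> X
        \<Longrightarrow> f t \<le> a + b * (LINT u:J t|lborel. g u)"
    and t: "t \<in> X"
  shows "f t \<le> a * exp (b * \<tau> t)"
proof (cases "b = 0")
  case True
  then show ?thesis using step[of "\<lambda>_. K" t] bdd t by simp
next
  case False
  then have b: "0 < b" using b by simp
  define c where "c = 2 * b"
  define K' where "K' = max K 0"
  define g where "g n u = a * exp (b * \<tau> u) + (K' / 2 ^ n) * exp (c * \<tau> u)" for n :: nat and u
  have c: "0 < c" and K': "0 \<le> K'" using b by (auto simp: c_def K'_def)
  have g: "continuous_on X (g n)" for n unfolding g_def by (intro continuous_intros \<tau>)
  have int: "set_integrable lborel (J t) (\<lambda>u. exp (d * \<tau> u))" if "t \<in> X" for t d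
    unfolding set_integrable_def using that J
    by (intro borel_integrable_compact continuous_intros continuous_on_subset[OF \<tau>(1)]) auto
  have le: "f u \<le> g n u" if "u \<in> X" for n u
    using that
  proof (induction n arbitrary: u)
    case 0
    have "f u \<le> K' * 1" using bdd[of u] 0 by (simp add: K'_def)
    also have "\<dots> \<le> K' * exp (c * \<tau> u)" using K' c \<tau>(2)[of u] 0 by (intro mult_left_mono) auto
    also have "\<dots> \<le> g 0 u" using a by (simp add: g_def)
    finally show ?case .
  next
    case (Suc n)
    have "f u \<le> a + b * (LINT u:J u|lborel. g n u)" by (intro step g Suc)
    also have "(LINT u:J u|lborel. g n u) = a * ((exp (b * \<tau> u) - 1) / b) + (K' / 2 ^ n) * ((exp (c * \<tau> u) - 1) / c)"
      unfolding g_def using int[of u] Suc.prems b c by (simp add: exp_int)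
    also have "a + b * \<dots> = a * exp (b * \<tau> u) + (K' / 2 ^ Suc n) * (exp (c * \<tau> u) - 1)"
      using b by (simp add: c_def field_simps)
    also have "\<dots> \<le> g (Suc n) u" 
      unfolding g_def using K' by (intro add_left_mono mult_left_mono) auto
    finally show ?case .
  qed
  have "(\<lambda>n. a * exp (b * \<tau> t) + K' * exp (c * \<tau> t) * (1 / 2) ^ n) \<longlonglongrightarrow> a * exp (b * \<tau> t) + K' * exp (c * \<tau> t) * 0"
    by (intro tendsto_intros LIMSEQ_power_zero) auto
  then show ?thesis
    using le[OF t] by (intro LIMSEQ_le_const[of _ "a * exp (b * \<tau> t)"]) (auto simp: g_def power_divide mult_ac)
qed

lemma gronwall_forward:
  fixes f :: "real \<Rightarrow> real"
  assumes "0 \<le> a" and "0 \<le> b" and "\<And>t. t \<in> {0..T} \<Longrightarrow> f t \<le> K"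
    and step: "\<And>g t. continuous_on {0..T} g \<Longrightarrow> (\<And>u. u \<in> {0..T} \<Longrightarrow> f u \<le> g u) \<Longrightarrow> t \<in> {0..T}
        \<Longrightarrow> f t \<le> a + b * (LINT u:{0..t}|lborel. g u)"
    and "t \<in> {0..T}"
  shows "f t \<le> a * exp (b * t)"
proof (rule gronwall_majorants[where \<tau> = "\<lambda>t. t" and J = "\<lambda>t. {0..t}" and X = "{0..T}"])
  show "(LINT u:{0..t}|lborel. exp (c * u)) = (exp (c * t) - 1) / c" if "t \<in> {0..T}" "0 < c" for t c
  proof -
    have "(LINT u:{0..t}|lborel. exp (c * u)) = exp (c * t) / c - exp (c * 0) / c"
      unfolding set_lebesgue_integral_def using that
      by (intro integral_FTC_atLeastAtMost)
        (auto intro!: derivative_eq_intros continuous_intros simp: has_real_derivative_iff_has_vector_derivative[symmetric])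
    then show ?thesis by (simp add: diff_divide_distrib)
  qed
qed (use assms in auto)

lemma gronwall_backward:
  fixes f :: "real \<Rightarrow> real"
  assumes "0 \<le> a" and "0 \<le> b" and "\<And>t. t \<in> {0..T} \<Longrightarrow> f t \<le> K"
    and step: "\<And>g t. continuous_on {0..T} g \<Longrightarrow> (\<And>u. u \<in> {0..T} \<Longrightarrow> f u \<le> g u) \<Longrightarrow> t \<in> {0..T}
        \<Longrightarrow> f t \<le> a + b * (LINT u:{t..T}|lborel. g u)"
    and "t \<in> {0..T}"
  shows "f t \<le> a * exp (b * (T - t))"
proof (rule gronwall_majorants[where \<tau> = "\<lambda>t. T - t" and J = "\<lambda>t. {t..T}" and X = "{0..T}"])
  show "(LINT u:{t..T}|lborel. exp (c * (T - u))) = (exp (c * (T - t)) - 1) / c" if "t \<in> {0..T}" "0 < c" for t c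
  proof -
    have "(LINT u:{t..T}|lborel. exp (c * (T - u))) = - exp (c * (T - T)) / c - (- exp (c * (T - t)) / c)"
      unfolding set_lebesgue_integral_def using that
      by (intro integral_FTC_atLeastAtMost)
        (auto intro!: derivative_eq_intros continuous_intros simp: has_real_derivative_iff_has_vector_derivative[symmetric])
    then show ?thesis by (simp add: diff_divide_distrib)
  qed
qed (use assms in \<open>auto intro!: continuous_intros\<close>)

section \<open>The Riccati equation and the forward-backward system\<close>

text \<open>
  A non-integrable \<open>f\<close> has integral \<open>0\<close>, so the inequality holds for it as well.  This matters in
  \<open>riccati_norm_le\<close>, where integrability is only available once the bound has been proved.
\<close>

lemma set_integral_inner_nonneg:
  fixes f :: "'a \<Rightarrow> 'b::{real_inner, banach, second_countable_topology}"
  assumes "\<And>u. u \<in> X \<Longrightarrow> 0 \<le> f u \<bullet> x"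
  shows "0 \<le> (LINT u:X|M. f u) \<bullet> x"
proof (cases "set_integrable M X f")
  case True
  then have "(LINT u:X|M. f u) \<bullet> x = (\<integral>u. (indicator X u *\<^sub>R f u) \<bullet> x \<partial>M)"
    unfolding set_lebesgue_integral_def set_integrable_def by (intro integral_inner_left[symmetric])
  also have "0 \<le> \<dots>" using assms by (intro Bochner_Integration.integral_nonneg) (auto simp: indicator_def)
  finally show ?thesis .
next
  case False
  then show ?thesis by (simp add: set_lebesgue_integral_def set_integrable_def not_integrable_integral_eq)
qed

text \<open>
  Polarisation: \<open>4 (P x \<bullet> y)\<close> is a difference of two values of the quadratic form, and the subtracted one
  is nonnegative.  The vector \<open>y\<close> is taken parallel to \<open>P x\<close> and as long as \<open>x\<close>.
\<close>

lemma norm_le_of_quadratic_form: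
  fixes P :: "'a::real_inner \<Rightarrow>\<^sub>L 'a"
  assumes P: "P \<in> Sigma_plus" and b: "0 \<le> b" and le: "\<And>x. P x \<bullet> x \<le> b * (norm x)\<^sup>2"
  shows "norm P \<le> b"
proof (rule norm_blinfun_bound[OF b])
  fix x
  have sym: "P x \<bullet> y = x \<bullet> P y" and nn: "0 \<le> P y \<bullet> y" for x y
    using P by (auto simp: Sigma_plus_def Sigma_sa_def)
  show "norm (P x) \<le> b * norm x"
  proof (cases "P x = 0")
    case False
    then have x: "norm x > 0" by (metis blinfun.zero_right zero_less_norm_iff)
    define y where "y = (norm x / norm (P x)) *\<^sub>R P x"
    have y: "norm y = norm x" using False by (simp add: y_def)
    have "4 * (P x \<bullet> y) = P (x + y) \<bullet> (x + y) - P (x - y) \<bullet> (x - y)"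
      using sym[of x y] by (simp add: blinfun.add_right blinfun.diff_right inner_add_left inner_add_right
          inner_diff_left inner_diff_right inner_commute)
    also have "\<dots> \<le> b * (norm (x + y))\<^sup>2" using le[of "x + y"] nn[of "x - y"] by linarith
    also have "\<dots> \<le> b * (2 * norm x)\<^sup>2"
      using norm_triangle_ineq[of x y] y by (intro mult_left_mono power_mono b) auto
    finally have "P x \<bullet> y \<le> b * norm x * norm x" by (simp add: power2_eq_square)
    moreover have "P x \<bullet> y = norm (P x) * norm x"
      using False by (simp add: y_def dot_square_norm power2_eq_square)
    ultimately show ?thesis using x by simp
  qed (simp add: b)
qed

text \<open>
  The analytic data of the problem on a bounded horizon: \<open>E\<close> and \<open>E'\<close> stand for the semigroups of \<open>A\<close> and
  of its adjoint, and \<open>G\<close> stands for \<open>B R\<inverse> B\<^sup>*\<close>.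
\<close>

locale semigroup_pair =
  fixes E E' :: "real \<Rightarrow> ('h::{real_inner, banach, second_countable_topology} \<Rightarrow>\<^sub>L 'h)"
    and G :: "'h \<Rightarrow>\<^sub>L 'h" and N T :: real
  assumes T: "0 \<le> T"
    and bound: "\<And>t. t \<in> {0..T} \<Longrightarrow> norm (E t) \<le> N"
    and bound': "\<And>t. t \<in> {0..T} \<Longrightarrow> norm (E' t) \<le> N"
    and cont: "\<And>x. continuous_on {0..T} (\<lambda>t. E t x)"
    and cont': "\<And>x. continuous_on {0..T} (\<lambda>t. E' t x)"
begin

lemma N_nonneg: "0 \<le> N"
  using order_trans[OF norm_ge_zero bound[of 0]] T by simp

lemma E_le: "t \<in> {0..T} \<Longrightarrow> norm v \<le> c \<Longrightarrow> norm (E t v) \<le> N * c"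
  using N_nonneg by (intro order_trans[OF norm_blinfun] mult_mono bound) auto

lemma E'_le: "t \<in> {0..T} \<Longrightarrow> norm v \<le> c \<Longrightarrow> norm (E' t v) \<le> N * c"
  using N_nonneg by (intro order_trans[OF norm_blinfun] mult_mono bound') auto

lemmas continuous_on_E = strongly_continuous_apply[OF cont bound]
lemmas continuous_on_E' = strongly_continuous_apply[OF cont' bound']

definition riccati :: "('h \<Rightarrow>\<^sub>L 'h) \<Rightarrow> ('h \<Rightarrow>\<^sub>L 'h) \<Rightarrow> (real \<Rightarrow> ('h \<Rightarrow>\<^sub>L 'h)) \<Rightarrow> bool" where
  "riccati WT W P \<longleftrightarrow> P \<in> Cs T \<and> (\<forall>t\<in>{0..T}. \<forall>x. P t x = E' (T - t) (WT (E (T - t) x))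
      + (LINT u:{t..T}|lborel. E' (u - t) (W (E (u - t) x)))
      - (LINT u:{t..T}|lborel. E' (u - t) (P u (G (P u (E (u - t) x))))))"

text \<open>
  In the quadratic form of the equation the term with \<open>P G P\<close> is nonnegative, by duality of \<open>E\<close> and \<open>E'\<close>
  and symmetry of \<open>P\<close>, and it enters with a minus sign.  What remains bounds \<open>P t x \<bullet> x\<close> by the data, and
  a nonnegative operator is controlled by its quadratic form.
\<close>

lemma riccati_norm_le:
  assumes ric: "riccati WT W P" and G: "\<And>x. 0 \<le> G x \<bullet> x"
    and adj: "\<And>t x y. t \<in> {0..T} \<Longrightarrow> E t x \<bullet> y = x \<bullet> E' t y"
    and t: "t \<in> {0..T}"
  shows "norm (P t) \<le> N\<^sup>2 * (norm WT + T * norm W)"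
proof (rule norm_le_of_quadratic_form)
  have Cs: "P \<in> Cs T" and eq: "P t x = E' (T - t) (WT (E (T - t) x))
      + (LINT u:{t..T}|lborel. E' (u - t) (W (E (u - t) x)))
      - (LINT u:{t..T}|lborel. E' (u - t) (P u (G (P u (E (u - t) x)))))" for x
    using ric t unfolding riccati_def by auto
  have sym: "P u x \<bullet> y = x \<bullet> P u y" if "u \<in> {0..T}" for u x y
    using Cs that by (auto simp: Cs_def Sigma_plus_def Sigma_sa_def)
  show "P t \<in> Sigma_plus" using Cs t by (simp add: Cs_def)
  show "0 \<le> N\<^sup>2 * (norm WT + T * norm W)" using T by simp
  show "P t x \<bullet> x \<le> N\<^sup>2 * (norm WT + T * norm W) * (norm x)\<^sup>2" for x
  proof -
    have EWE: "norm (E' s (V (E s x))) \<le> N * (norm V * (N * norm x))" if "s \<in> {0..T}" for s and V :: "'h \<Rightarrow>\<^sub>L 'h"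
      by (intro E'_le that order_trans[OF norm_blinfun] mult_left_mono E_le) auto
    have "(E' (T - t) (WT (E (T - t) x))) \<bullet> x \<le> norm (E' (T - t) (WT (E (T - t) x))) * norm x"
      by (rule norm_cauchy_schwarz)
    also have "\<dots> \<le> N * (norm WT * (N * norm x)) * norm x"
      using t by (intro mult_right_mono EWE) auto
    finally have 1: "(E' (T - t) (WT (E (T - t) x))) \<bullet> x \<le> N\<^sup>2 * norm WT * (norm x)\<^sup>2"
      by (simp add: power2_eq_square mult_ac)
    have "norm (LINT u:{t..T}|lborel. E' (u - t) (W (E (u - t) x)))
        \<le> (LINT u:{t..T}|lborel. N * (norm W * (N * norm x)))"
      using t by (intro norm_set_integral_le EWE continuous_on_E' continuous_on_E continuous_intros) auto
    also have "\<dots> = (T - t) * (N * (norm W * (N * norm x)))"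
      using t by (simp add: set_lebesgue_integral_def)
    also have "\<dots> \<le> T * (N * (norm W * (N * norm x)))"
      using t N_nonneg by (intro mult_right_mono) auto
    finally have "norm (LINT u:{t..T}|lborel. E' (u - t) (W (E (u - t) x))) * norm x
        \<le> T * (N * (norm W * (N * norm x))) * norm x" by (rule mult_right_mono) simp
    then have 2: "(LINT u:{t..T}|lborel. E' (u - t) (W (E (u - t) x))) \<bullet> x \<le> N\<^sup>2 * (T * norm W) * (norm x)\<^sup>2"
      using norm_cauchy_schwarz[of "LINT u:{t..T}|lborel. E' (u - t) (W (E (u - t) x))" x]
      by (simp add: power2_eq_square mult_ac)
    have 3: "0 \<le> (LINT u:{t..T}|lborel. E' (u - t) (P u (G (P u (E (u - t) x))))) \<bullet> x"
    proof (rule set_integral_inner_nonneg)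
      fix u assume u: "u \<in> {t..T}"
      define v where "v = E (u - t) x"
      have "E' (u - t) (P u (G (P u v))) \<bullet> x = v \<bullet> P u (G (P u v))"
        using adj[of "u - t" x "P u (G (P u v))"] u t by (simp add: v_def inner_commute)
      also have "\<dots> = G (P u v) \<bullet> P u v" using sym[of u v "G (P u v)"] u t by (simp add: inner_commute)
      finally show "0 \<le> E' (u - t) (P u (G (P u (E (u - t) x)))) \<bullet> x" using G by (simp add: v_def)
    qed
    have "P t x \<bullet> x \<le> N\<^sup>2 * norm WT * (norm x)\<^sup>2 + N\<^sup>2 * (T * norm W) * (norm x)\<^sup>2"
      using 1 2 3 by (subst eq) (simp add: inner_add_left inner_diff_left)
    then show ?thesis by (simp add: algebra_simps)
  qed
qed

text \<open>
  The difference of the quadratic terms is \<open>(P2 - P1) G P2 + P1 G (P2 - P1)\<close>, so the operator norm of the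
  difference satisfies a homogeneous Gronwall inequality.
\<close>

lemma riccati_unique:
  assumes ric1: "riccati WT W P1" and ric2: "riccati WT W P2"
    and b1: "\<And>t. t \<in> {0..T} \<Longrightarrow> norm (P1 t) \<le> \<beta>" and b2: "\<And>t. t \<in> {0..T} \<Longrightarrow> norm (P2 t) \<le> \<beta>"
    and t: "t \<in> {0..T}"
  shows "P1 t = P2 t"
proof -
  have \<beta>: "0 \<le> \<beta>" using order_trans[OF norm_ge_zero b1[OF t]] .
  define I where "I P t x u = E' (u - t) (P u (G (P u (E (u - t) x))))" for P :: "real \<Rightarrow> 'h \<Rightarrow>\<^sub>L 'h" and t x u
  have Pcont: "continuous_on {0..T} (\<lambda>t. P1 t x)" "continuous_on {0..T} (\<lambda>t. P2 t x)" for x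
    using ric1 ric2 by (auto simp: riccati_def Cs_def)
  have Icont: "continuous_on {t..T} (I P t x)"
    if "\<And>x. continuous_on {0..T} (\<lambda>t. P t x)" "\<And>t. t \<in> {0..T} \<Longrightarrow> norm (P t) \<le> \<beta>" "t \<in> {0..T}"
    for P :: "real \<Rightarrow> ('h \<Rightarrow>\<^sub>L 'h)" and t x
    unfolding I_def using that(3)
    by (intro continuous_on_E' continuous_on_E strongly_continuous_apply[OF that(1,2), where \<phi> = "\<lambda>u. u"]
        continuous_intros) auto
  define b where "b = 2 * (N * N * norm G * \<beta>)"
  have b: "0 \<le> b" using N_nonneg \<beta> by (simp add: b_def)
  have "norm (P1 t - P2 t) \<le> 0 * exp (b * (T - t))"
  proof (rule gronwall_backward)
    show "norm (P1 t - P2 t) \<le> 2 * \<beta>" if "t \<in> {0..T}" for t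
      using norm_triangle_ineq4[of "P1 t" "P2 t"] b1 b2 that by fastforce
    fix g t assume g: "continuous_on {0..T} g" and le: "\<And>u. u \<in> {0..T} \<Longrightarrow> norm (P1 u - P2 u) \<le> g u"
      and t: "t \<in> {0..T}"
    have gint: "continuous_on {t..T} g" using t by (intro continuous_on_subset[OF g]) auto
    have gnn: "0 \<le> g u" if "u \<in> {t..T}" for u
      using order_trans[OF norm_ge_zero le[of u]] that t by auto
    have J: "0 \<le> (LINT u:{t..T}|lborel. g u)"
      unfolding set_lebesgue_integral_def
      by (intro Bochner_Integration.integral_nonneg) (auto simp: indicator_def gnn)
    show "norm (P1 t - P2 t) \<le> 0 + b * (LINT u:{t..T}|lborel. g u)"
    proof (rule norm_blinfun_bound)
      fix x
      have I1: "continuous_on {t..T} (I P1 t x)" and I2: "continuous_on {t..T} (I P2 t x)"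
        by (intro Icont Pcont b1 b2 t; assumption)+
      have "(P1 t - P2 t) x = (LINT u:{t..T}|lborel. I P2 t x u) - (LINT u:{t..T}|lborel. I P1 t x u)"
        using ric1 ric2 t by (simp add: riccati_def I_def blinfun.diff_left)
      also have "\<dots> = (LINT u:{t..T}|lborel. I P2 t x u - I P1 t x u)"
        using I1 I2 by (simp add: borel_integrable_atLeastAtMost')
      also have "norm \<dots> \<le> (LINT u:{t..T}|lborel. (b * norm x) * g u)"
      proof (rule norm_set_integral_le)
        show "continuous_on {t..T} (\<lambda>u. I P2 t x u - I P1 t x u)" by (intro continuous_intros I1 I2)
        show "continuous_on {t..T} (\<lambda>u. b * norm x * g u)" by (intro continuous_intros gint)
        fix u assume u: "u \<in> {t..T}"
        have uT: "u \<in> {0..T}" "u - t \<in> {0..T}" using u t by auto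
        define v where "v = E (u - t) x"
        have v: "norm v \<le> N * norm x" unfolding v_def by (intro E_le uT) simp
        have d: "norm (P2 u - P1 u) \<le> g u" using le[OF uT(1)] by (simp add: norm_minus_commute)
        have "I P2 t x u - I P1 t x u = E' (u - t) ((P2 u - P1 u) (G (P2 u v)) + P1 u (G ((P2 u - P1 u) v)))"
          by (simp add: I_def v_def blinfun.diff_left blinfun.diff_right blinfun.add_right)
        also have "norm \<dots> \<le> N * (g u * (norm G * (\<beta> * (N * norm x))) + \<beta> * (norm G * (g u * (N * norm x))))"
          using d v b1[OF uT(1)] b2[OF uT(1)] gnn[OF u] \<beta> N_nonneg
          by (intro E'_le uT norm_triangle_mono order_trans[OF norm_blinfun] mult_mono order_refl
              mult_nonneg_nonneg norm_ge_zero) auto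
        also have "\<dots> = b * norm x * g u" by (simp add: b_def algebra_simps)
        finally show "norm (I P2 t x u - I P1 t x u) \<le> b * norm x * g u" .
      qed
      also have "\<dots> = (0 + b * (LINT u:{t..T}|lborel. g u)) * norm x" by simp
      finally show "norm ((P1 t - P2 t) x) \<le> (0 + b * (LINT u:{t..T}|lborel. g u)) * norm x" .
    qed (use J b in simp)
  qed (use b t in auto)
  then show ?thesis by simp
qed

text \<open>
  The first half of the fixed point argument: the forward equation determines \<open>z\<close> from \<open>r\<close>, and Gronwall
  absorbs the feedback term \<open>G P z\<close>.
\<close>

lemma forward_estimate:
  fixes P :: "real \<Rightarrow> ('h \<Rightarrow>\<^sub>L 'h)"
  assumes P: "\<And>x. continuous_on {0..T} (\<lambda>t. P t x)" "\<And>t. t \<in> {0..T} \<Longrightarrow> norm (P t) \<le> \<beta>"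
    and z: "continuous_on {0..T} z" and r: "continuous_on {0..T} r"
    and eq: "\<And>t. t \<in> {0..T} \<Longrightarrow> z t = - (LINT u:{0..t}|lborel. E (t - u) (G (P u (z u))))
        - (LINT u:{0..t}|lborel. E (t - u) (G (r u)))"
    and rle: "\<And>t. t \<in> {0..T} \<Longrightarrow> norm (r t) \<le> \<rho>"
    and t: "t \<in> {0..T}"
  shows "norm (z t) \<le> N * norm G * T * \<rho> * exp (N * norm G * \<beta> * T)"
proof -
  have \<beta>: "0 \<le> \<beta>" using order_trans[OF norm_ge_zero P(2)[OF t]] .
  have \<rho>: "0 \<le> \<rho>" using order_trans[OF norm_ge_zero rle[OF t]] .
  define b where "b = N * norm G * \<beta>"
  define a where "a = N * norm G * T * \<rho>"
  have ab: "0 \<le> a" "0 \<le> b" using N_nonneg \<beta> \<rho> T by (auto simp: a_def b_def)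
  have "bounded (z ` {0..T})" by (intro compact_imp_bounded compact_continuous_image z compact_Icc)
  then obtain K where K: "\<And>t. t \<in> {0..T} \<Longrightarrow> norm (z t) \<le> K" unfolding bounded_iff by blast
  have "norm (z t) \<le> a * exp (b * t)"
  proof (rule gronwall_forward[OF ab K _ t])
    fix g t assume g: "continuous_on {0..T} g" and le: "\<And>u. u \<in> {0..T} \<Longrightarrow> norm (z u) \<le> g u"
      and t: "t \<in> {0..T}"
    have sub: "{0..t} \<subseteq> {0..T}" using t by auto
    have "norm (LINT u:{0..t}|lborel. E (t - u) (G (P u (z u)))) \<le> (LINT u:{0..t}|lborel. b * g u)"
    proof (rule norm_set_integral_le)
      show "continuous_on {0..t} (\<lambda>u. E (t - u) (G (P u (z u))))"
        using t by (intro continuous_on_E strongly_continuous_apply[OF P, where \<phi> = "\<lambda>u. u"] continuous_intros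
            continuous_on_subset[OF z sub]) auto
      show "continuous_on {0..t} (\<lambda>u. b * g u)" by (intro continuous_intros continuous_on_subset[OF g sub])
      fix u assume u: "u \<in> {0..t}"
      then have "norm (E (t - u) (G (P u (z u)))) \<le> N * (norm G * (\<beta> * g u))"
        using t P(2)[of u] le[of u] \<beta> by (intro E_le order_trans[OF norm_blinfun] mult_mono order_refl) auto
      then show "norm (E (t - u) (G (P u (z u)))) \<le> b * g u" by (simp add: b_def mult_ac)
    qed
    moreover have "norm (LINT u:{0..t}|lborel. E (t - u) (G (r u))) \<le> (LINT u:{0..t}|lborel. N * (norm G * \<rho>))"
    proof (rule norm_set_integral_le)
      show "continuous_on {0..t} (\<lambda>u. E (t - u) (G (r u)))"
        using t by (intro continuous_on_E continuous_intros continuous_on_subset[OF r sub]) auto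
      show "norm (E (t - u) (G (r u))) \<le> N * (norm G * \<rho>)" if "u \<in> {0..t}" for u
        using t that rle[of u] by (intro E_le order_trans[OF norm_blinfun] mult_left_mono) auto
    qed auto
    moreover have "(LINT u:{0..t}|lborel. N * (norm G * \<rho>)) \<le> a"
    proof -
      have "(LINT u:{0..t}|lborel. N * (norm G * \<rho>)) = N * norm G * t * \<rho>"
        using t by (simp add: set_lebesgue_integral_def)
      also have "\<dots> \<le> a" unfolding a_def using t N_nonneg \<rho> by (intro mult_right_mono mult_left_mono) auto
      finally show ?thesis .
    qed
    ultimately show "norm (z t) \<le> a + b * (LINT u:{0..t}|lborel. g u)"
      unfolding eq[OF t]
      using norm_triangle_ineq4[of "- (LINT u:{0..t}|lborel. E (t - u) (G (P u (z u))))" "LINT u:{0..t}|lborel. E (t - u) (G (r u))"]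
      by simp
  qed
  also have "\<dots> \<le> a * exp (b * T)" using t ab by (intro mult_left_mono) (auto intro: mult_left_mono)
  finally show ?thesis by (simp add: a_def b_def)
qed

text \<open>
  The second half: the backward equation determines \<open>r\<close> from \<open>z\<close>, again with the feedback term \<open>P G r\<close>
  absorbed by Gronwall.
\<close>

lemma backward_estimate:
  fixes P :: "real \<Rightarrow> ('h \<Rightarrow>\<^sub>L 'h)" and L\<^sub>T L :: "'h \<Rightarrow>\<^sub>L 'h"
  assumes P: "\<And>x. continuous_on {0..T} (\<lambda>t. P t x)" "\<And>t. t \<in> {0..T} \<Longrightarrow> norm (P t) \<le> \<beta>"
    and z: "continuous_on {0..T} z" and r: "continuous_on {0..T} r"
    and eq: "\<And>t. t \<in> {0..T} \<Longrightarrow> r t = - E' (T - t) (L\<^sub>T (z T))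
        - (LINT u:{t..T}|lborel. E' (u - t) (P u (G (r u))))
        - (LINT u:{t..T}|lborel. E' (u - t) (L (z u)))"
    and zle: "\<And>t. t \<in> {0..T} \<Longrightarrow> norm (z t) \<le> \<zeta>"
    and t: "t \<in> {0..T}"
  shows "norm (r t) \<le> N * (norm L\<^sub>T + norm L * T) * \<zeta> * exp (N * norm G * \<beta> * T)"
proof -
  have \<beta>: "0 \<le> \<beta>" using order_trans[OF norm_ge_zero P(2)[OF t]] .
  have \<zeta>: "0 \<le> \<zeta>" using order_trans[OF norm_ge_zero zle[OF t]] .
  define b where "b = N * norm G * \<beta>"
  define a where "a = N * (norm L\<^sub>T + norm L * T) * \<zeta>"
  have ab: "0 \<le> a" "0 \<le> b" using N_nonneg \<beta> \<zeta> T by (auto simp: a_def b_def)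
  have "bounded (r ` {0..T})" by (intro compact_imp_bounded compact_continuous_image r compact_Icc)
  then obtain K where K: "\<And>t. t \<in> {0..T} \<Longrightarrow> norm (r t) \<le> K" unfolding bounded_iff by blast
  have "norm (r t) \<le> a * exp (b * (T - t))"
  proof (rule gronwall_backward[OF ab K _ t])
    fix g t assume g: "continuous_on {0..T} g" and le: "\<And>u. u \<in> {0..T} \<Longrightarrow> norm (r u) \<le> g u"
      and t: "t \<in> {0..T}"
    have sub: "{t..T} \<subseteq> {0..T}" using t by auto
    have "norm (LINT u:{t..T}|lborel. E' (u - t) (P u (G (r u)))) \<le> (LINT u:{t..T}|lborel. b * g u)"
    proof (rule norm_set_integral_le)
      show "continuous_on {t..T} (\<lambda>u. E' (u - t) (P u (G (r u))))"
        using t by (intro continuous_on_E' strongly_continuous_apply[OF P, where \<phi> = "\<lambda>u. u"] continuous_intros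
            continuous_on_subset[OF r sub]) auto
      show "continuous_on {t..T} (\<lambda>u. b * g u)" by (intro continuous_intros continuous_on_subset[OF g sub])
      fix u assume u: "u \<in> {t..T}"
      then have "norm (E' (u - t) (P u (G (r u)))) \<le> N * (\<beta> * (norm G * g u))"
        using t P(2)[of u] le[of u] \<beta> by (intro E'_le order_trans[OF norm_blinfun] mult_mono order_refl) auto
      then show "norm (E' (u - t) (P u (G (r u)))) \<le> b * g u" by (simp add: b_def mult_ac)
    qed
    moreover have "norm (LINT u:{t..T}|lborel. E' (u - t) (L (z u))) \<le> (LINT u:{t..T}|lborel. N * (norm L * \<zeta>))"
    proof (rule norm_set_integral_le)
      show "continuous_on {t..T} (\<lambda>u. E' (u - t) (L (z u)))"
        using t by (intro continuous_on_E' continuous_intros continuous_on_subset[OF z sub]) auto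
      show "norm (E' (u - t) (L (z u))) \<le> N * (norm L * \<zeta>)" if "u \<in> {t..T}" for u
        using t that zle[of u] by (intro E'_le order_trans[OF norm_blinfun] mult_left_mono) auto
    qed auto
    moreover have "(LINT u:{t..T}|lborel. N * (norm L * \<zeta>)) \<le> N * norm L * T * \<zeta>"
    proof -
      have "(LINT u:{t..T}|lborel. N * (norm L * \<zeta>)) = N * norm L * (T - t) * \<zeta>"
        using t by (simp add: set_lebesgue_integral_def)
      also have "\<dots> \<le> N * norm L * T * \<zeta>" using t N_nonneg \<zeta> by (intro mult_right_mono mult_left_mono) auto
      finally show ?thesis .
    qed
    moreover have "norm (E' (T - t) (L\<^sub>T (z T))) \<le> N * (norm L\<^sub>T * \<zeta>)"
      using t T zle[of T] by (intro E'_le order_trans[OF norm_blinfun] mult_left_mono) auto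
    moreover have "a = N * (norm L\<^sub>T * \<zeta>) + N * norm L * T * \<zeta>" by (simp add: a_def algebra_simps)
    moreover have "norm (- x - y - w) \<le> norm x + norm y + norm w" for x y w :: 'h
      using norm_triangle_ineq4[of "- x - y" w] norm_triangle_ineq4[of "- x" y] by simp
    ultimately show "norm (r t) \<le> a + b * (LINT u:{t..T}|lborel. g u)"
      unfolding eq[OF t] set_integral_mult_right by (smt (verit))
  qed
  also have "\<dots> \<le> a * exp (b * T)" using t ab by (intro mult_left_mono) (auto intro: mult_left_mono)
  finally show ?thesis by (simp add: a_def b_def)
qed

text \<open>
  The product of the two gains is the left side of \<open>small\<close>, so the maximum of \<open>norm (r t)\<close> is at most a
  factor less than \<open>1\<close> times itself.
\<close>

lemma forward_backward_zero:
  fixes P :: "real \<Rightarrow> ('h \<Rightarrow>\<^sub>L 'h)" and L\<^sub>T L :: "'h \<Rightarrow>\<^sub>L 'h"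
  assumes P: "\<And>x. continuous_on {0..T} (\<lambda>t. P t x)" "\<And>t. t \<in> {0..T} \<Longrightarrow> norm (P t) \<le> \<beta>"
    and z: "continuous_on {0..T} z" and r: "continuous_on {0..T} r"
    and zeq: "\<And>t. t \<in> {0..T} \<Longrightarrow> z t = - (LINT u:{0..t}|lborel. E (t - u) (G (P u (z u))))
        - (LINT u:{0..t}|lborel. E (t - u) (G (r u)))"
    and req: "\<And>t. t \<in> {0..T} \<Longrightarrow> r t = - E' (T - t) (L\<^sub>T (z T))
        - (LINT u:{t..T}|lborel. E' (u - t) (P u (G (r u))))
        - (LINT u:{t..T}|lborel. E' (u - t) (L (z u)))"
    and small: "N\<^sup>2 * (norm L\<^sub>T + norm L * T) * T * norm G * exp (2 * (N * norm G * \<beta> * T)) < 1"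
    and t: "t \<in> {0..T}"
  shows "z t = 0 \<and> r t = 0"
proof -
  have "\<exists>t0\<in>{0..T}. \<forall>t\<in>{0..T}. norm (r t) \<le> norm (r t0)"
    using T by (intro continuous_attains_sup continuous_intros r) auto
  then obtain t0 where t0: "t0 \<in> {0..T}" and max: "\<And>t. t \<in> {0..T} \<Longrightarrow> norm (r t) \<le> norm (r t0)"
    by blast
  define \<rho> where "\<rho> = norm (r t0)"
  define e where "e = exp (N * norm G * \<beta> * T)"
  define \<zeta> where "\<zeta> = N * norm G * T * \<rho> * e"
  have zle: "norm (z t) \<le> \<zeta>" if "t \<in> {0..T}" for t
    unfolding \<zeta>_def \<rho>_def e_def by (rule forward_estimate[OF P z r zeq max that])
  have "\<rho> \<le> N * (norm L\<^sub>T + norm L * T) * \<zeta> * e"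
    unfolding \<rho>_def e_def by (rule backward_estimate[OF P z r req zle t0])
  also have "\<dots> = (N\<^sup>2 * (norm L\<^sub>T + norm L * T) * T * norm G * exp (2 * (N * norm G * \<beta> * T))) * \<rho>"
    unfolding \<zeta>_def e_def exp_double by (simp add: power2_eq_square mult_ac)
  finally have "\<rho> \<le> (N\<^sup>2 * (norm L\<^sub>T + norm L * T) * T * norm G * exp (2 * (N * norm G * \<beta> * T))) * \<rho>" .
  moreover have "0 \<le> \<rho>" by (simp add: \<rho>_def)
  ultimately have "\<rho> = 0" using small by (simp add: mult_le_cancel_right1 not_le)
  then show ?thesis using max[OF t] zle[OF t] by (simp add: \<rho>_def \<zeta>_def)
qed

lemma forward_backward_unique:
  fixes P :: "real \<Rightarrow> ('h \<Rightarrow>\<^sub>L 'h)" and L\<^sub>T L :: "'h \<Rightarrow>\<^sub>L 'h"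
  assumes P: "\<And>x. continuous_on {0..T} (\<lambda>t. P t x)" "\<And>t. t \<in> {0..T} \<Longrightarrow> norm (P t) \<le> \<beta>"
    and z1: "continuous_on {0..T} z1" and r1: "continuous_on {0..T} r1"
    and z2: "continuous_on {0..T} z2" and r2: "continuous_on {0..T} r2"
    and zeq1: "\<And>t. t \<in> {0..T} \<Longrightarrow> z1 t = E t z0 - (LINT u:{0..t}|lborel. E (t - u) (G (P u (z1 u))))
        - (LINT u:{0..t}|lborel. E (t - u) (G (r1 u)))"
    and zeq2: "\<And>t. t \<in> {0..T} \<Longrightarrow> z2 t = E t z0 - (LINT u:{0..t}|lborel. E (t - u) (G (P u (z2 u))))
        - (LINT u:{0..t}|lborel. E (t - u) (G (r2 u)))"
    and req1: "\<And>t. t \<in> {0..T} \<Longrightarrow> r1 t = - E' (T - t) (L\<^sub>T (z1 T))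
        - (LINT u:{t..T}|lborel. E' (u - t) (P u (G (r1 u))))
        - (LINT u:{t..T}|lborel. E' (u - t) (L (z1 u)))"
    and req2: "\<And>t. t \<in> {0..T} \<Longrightarrow> r2 t = - E' (T - t) (L\<^sub>T (z2 T))
        - (LINT u:{t..T}|lborel. E' (u - t) (P u (G (r2 u))))
        - (LINT u:{t..T}|lborel. E' (u - t) (L (z2 u)))"
    and small: "N\<^sup>2 * (norm L\<^sub>T + norm L * T) * T * norm G * exp (2 * (N * norm G * \<beta> * T)) < 1"
    and t: "t \<in> {0..T}"
  shows "z1 t = z2 t \<and> r1 t = r2 t"
proof -
  define z r where "z t = z1 t - z2 t" and "r t = r1 t - r2 t" for t
  have z: "continuous_on {0..T} z" and r: "continuous_on {0..T} r"
    unfolding z_def r_def by (intro continuous_intros z1 z2 r1 r2)+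
  have "z t = 0 \<and> r t = 0"
  proof (rule forward_backward_zero[OF P z r _ _ small t])
    fix t assume t: "t \<in> {0..T}"
    have sub: "{0..t} \<subseteq> {0..T}" "{t..T} \<subseteq> {0..T}" using t by auto
    have EGP: "set_integrable lborel {0..t} (\<lambda>u. E (t - u) (G (P u (f u))))"
      and EG: "set_integrable lborel {0..t} (\<lambda>u. E (t - u) (G (f u)))"
      and EPG: "set_integrable lborel {t..T} (\<lambda>u. E' (u - t) (P u (G (f u))))"
      and EL: "set_integrable lborel {t..T} (\<lambda>u. E' (u - t) (L (f u)))"
      if f: "continuous_on {0..T} f" for f
      using t by (intro borel_integrable_atLeastAtMost' continuous_on_E continuous_on_E'
          strongly_continuous_apply[OF P, where \<phi> = "\<lambda>u. u"] continuous_intros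
          continuous_on_subset[OF f sub(1)] continuous_on_subset[OF f sub(2)]; auto)+
    show "z t = - (LINT u:{0..t}|lborel. E (t - u) (G (P u (z u)))) - (LINT u:{0..t}|lborel. E (t - u) (G (r u)))"
      unfolding z_def r_def blinfun.diff_right
        set_integral_diff(2)[OF EGP[OF z1] EGP[OF z2]] set_integral_diff(2)[OF EG[OF r1] EG[OF r2]]
      by (subst zeq1[OF t], subst zeq2[OF t]) simp
    show "r t = - E' (T - t) (L\<^sub>T (z T)) - (LINT u:{t..T}|lborel. E' (u - t) (P u (G (r u))))
        - (LINT u:{t..T}|lborel. E' (u - t) (L (z u)))"
      unfolding z_def r_def blinfun.diff_right
        set_integral_diff(2)[OF EPG[OF r1] EPG[OF r2]] set_integral_diff(2)[OF EL[OF z1] EL[OF z2]]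
      by (subst req1[OF t], subst req2[OF t]) simp
  qed
  then show ?thesis by (simp add: z_def r_def)
qed

end

section \<open>Uniqueness of LQM mild solutions\<close>

theorem proposition4p1:
  fixes D :: "'h::{real_inner, banach, second_countable_topology} set" and A :: "'h \<Rightarrow> 'h"
    and EA EAs :: "real \<Rightarrow> ('h \<Rightarrow>\<^sub>L 'h)"
    and B :: "'u::{real_inner, banach, second_countable_topology} \<Rightarrow>\<^sub>L 'h"
    and R :: "'u \<Rightarrow>\<^sub>L 'u"
    and Q QT Qb QbT S ST :: "'h \<Rightarrow>\<^sub>L 'h"
    and \<sigma> :: "'k::{real_inner, banach, second_countable_topology} \<Rightarrow>\<^sub>L 'h"
    and z0 :: 'h
    and \<epsilon> M \<omega> T C_BR C_QTST C_QS \<beta> :: real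
    and P1 P2 :: "real \<Rightarrow> ('h \<Rightarrow>\<^sub>L 'h)" and r1 r2 z1 z2 :: "real \<Rightarrow> 'h" and s1 s2 :: "real \<Rightarrow> real"
  assumes "closed_operator D A" and "closure D = UNIV"
    and "generates D A EA"
    and "generates (adj_dom D A) (adj_op D A) EAs"
    and "Q \<in> Sigma_plus" and "QT \<in> Sigma_plus"
    and "Qb \<in> Sigma_sa" and "QbT \<in> Sigma_sa"
    and "Q + Qb \<in> Sigma_plus" and "QT + QbT \<in> Sigma_plus"
    and "R \<in> Sigma_sa" and "0 < \<epsilon>" and "\<And>\<alpha> :: 'u. R \<alpha> \<bullet> \<alpha> \<ge> \<epsilon> * (norm \<alpha>)\<^sup>2"
    and "1 \<le> M" and "0 \<le> \<omega>"
    and "\<And>t. 0 \<le> t \<Longrightarrow> norm (EA t) \<le> M * exp (\<omega> * t)"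
    and "\<And>t. 0 \<le> t \<Longrightarrow> norm (EAs t) \<le> M * exp (\<omega> * t)"
    and "C_BR = norm (BRB B R)"
    and "C_QTST = norm (QbT o\<^sub>L ST)"
    and "C_QS = norm (Qb o\<^sub>L S)"
    and "\<beta> = M\<^sup>2 * exp (2 * \<omega> * T) * (norm (QT + QbT) + T * norm (Q + Qb))"
    and "0 < T"
    and "M\<^sup>2 * (C_QTST + C_QS * T) * T * C_BR
           * exp (2 * M * exp (\<omega> * T) * C_BR * \<beta> * T + 2 * \<omega> * T) < 1"
    and "LQM_mild_solution EA EAs B R Q QT Qb QbT S ST \<sigma> z0 T P1 r1 z1 s1"
    and "LQM_mild_solution EA EAs B R Q QT Qb QbT S ST \<sigma> z0 T P2 r2 z2 s2"
  shows "\<forall>t\<in>{0..T}. P1 t = P2 t \<and> r1 t = r2 t \<and> z1 t = z2 t \<and> s1 t = s2 t"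
proof -
  define N where "N = M * exp (\<omega> * T)"
  define G where "G = BRB B R"
  note dense = assms(2) and gen = assms(3) and gen' = assms(4) and R = assms(11-13)
    and M = assms(14) and \<omega> = assms(15) and bd = assms(16) and bd' = assms(17) and T = assms(22)
    and sol1 = assms(24)[unfolded LQM_mild_solution_def, folded G_def]
    and sol2 = assms(25)[unfolded LQM_mild_solution_def, folded G_def]
  have up: "M * exp (\<omega> * t) \<le> N" if "t \<in> {0..T}" for t
    unfolding N_def using that \<omega> M by (intro mult_left_mono) (auto intro: mult_left_mono)
  have bN: "norm (EA t) \<le> N" "norm (EAs t) \<le> N" if "t \<in> {0..T}" for t
    using that by (auto intro: order_trans[OF _ up[OF that]] bd bd')
  have C0: "C0_semigroup EA" "C0_semigroup EAs" using gen gen' by (auto simp: generates_def)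
  interpret semigroup_pair EA EAs G N T
  proof
    show "continuous_on {0..T} (\<lambda>t. EA t x)" "continuous_on {0..T} (\<lambda>t. EAs t x)" for x
      by (rule semigroup_continuous_on[OF C0(1) bN(1)] semigroup_continuous_on[OF C0(2) bN(2)]; assumption)+
  qed (use T bN in auto)
  have "N\<^sup>2 = M\<^sup>2 * exp (2 * \<omega> * T)"
    unfolding N_def power_mult_distrib exp_double[symmetric] by (simp add: mult.assoc)
  then have \<beta>: "\<beta> = N\<^sup>2 * (norm (QT + QbT) + T * norm (Q + Qb))" using assms(21) by simp
  have ric: "riccati (QT + QbT) (Q + Qb) P1" "riccati (QT + QbT) (Q + Qb) P2"
    using sol1 sol2 unfolding riccati_def by blast+
  have P\<beta>: "norm (P t) \<le> \<beta>" if "riccati (QT + QbT) (Q + Qb) P" "t \<in> {0..T}" for P t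
    unfolding \<beta>
  proof (rule riccati_norm_le[OF that(1) _ _ that(2)])
    show "0 \<le> G x \<bullet> x" for x unfolding G_def by (rule BRB_nonneg[OF R])
    show "EA t x \<bullet> y = x \<bullet> EAs t y" if "t \<in> {0..T}" for t x y
      using that by (intro semigroup_adjoint[OF dense gen gen' bd bd' \<omega>]) auto
  qed
  have Peq: "P1 t = P2 t" if "t \<in> {0..T}" for t
    using ric P\<beta>[OF ric(1)] P\<beta>[OF ric(2)] that by (rule riccati_unique)
  have zr: "z1 t = z2 t \<and> r1 t = r2 t" if t: "t \<in> {0..T}" for t
  proof (rule forward_backward_unique[where P = P1 and L\<^sub>T = "QbT o\<^sub>L ST" and L = "Qb o\<^sub>L S" and \<beta> = \<beta>, OF _ _ _ _ _ _ _ _ _ _ _ t])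
    show "continuous_on {0..T} (\<lambda>t. P1 t x)" for x using sol1 by (simp add: Cs_def)
    show "norm (P1 t) \<le> \<beta>" if "t \<in> {0..T}" for t by (rule P\<beta>[OF ric(1) that])
    show "continuous_on {0..T} z1" "continuous_on {0..T} r1" "continuous_on {0..T} z2" "continuous_on {0..T} r2"
      using sol1 sol2 by blast+
    show "z1 t = EA t z0 - (LINT u:{0..t}|lborel. EA (t - u) (G (P1 u (z1 u))))
        - (LINT u:{0..t}|lborel. EA (t - u) (G (r1 u)))" if "t \<in> {0..T}" for t
      using sol1 that by blast
    show "r1 t = - EAs (T - t) ((QbT o\<^sub>L ST) (z1 T)) - (LINT u:{t..T}|lborel. EAs (u - t) (P1 u (G (r1 u))))
        - (LINT u:{t..T}|lborel. EAs (u - t) ((Qb o\<^sub>L S) (z1 u)))" if "t \<in> {0..T}" for t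
      using sol1 that unfolding blinfun_apply_blinfun_compose by blast
    fix t assume t: "t \<in> {0..T}"
    have "(LINT u:{0..t}|lborel. EA (t - u) (G (P1 u (z2 u)))) = (LINT u:{0..t}|lborel. EA (t - u) (G (P2 u (z2 u))))"
      using t by (intro set_lebesgue_integral_cong) (auto simp: Peq)
    moreover have "z2 t = EA t z0 - (LINT u:{0..t}|lborel. EA (t - u) (G (P2 u (z2 u))))
        - (LINT u:{0..t}|lborel. EA (t - u) (G (r2 u)))" using sol2 t by blast
    ultimately show "z2 t = EA t z0 - (LINT u:{0..t}|lborel. EA (t - u) (G (P1 u (z2 u))))
        - (LINT u:{0..t}|lborel. EA (t - u) (G (r2 u)))" by (simp only:)
    have "(LINT u:{t..T}|lborel. EAs (u - t) (P1 u (G (r2 u)))) = (LINT u:{t..T}|lborel. EAs (u - t) (P2 u (G (r2 u))))"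
      using t by (intro set_lebesgue_integral_cong) (auto simp: Peq)
    moreover have "r2 t = - EAs (T - t) (QbT (ST (z2 T))) - (LINT u:{t..T}|lborel. EAs (u - t) (P2 u (G (r2 u))))
        - (LINT u:{t..T}|lborel. EAs (u - t) (Qb (S (z2 u))))" using sol2 t by blast
    ultimately show "r2 t = - EAs (T - t) ((QbT o\<^sub>L ST) (z2 T)) - (LINT u:{t..T}|lborel. EAs (u - t) (P1 u (G (r2 u))))
        - (LINT u:{t..T}|lborel. EAs (u - t) ((Qb o\<^sub>L S) (z2 u)))" by (simp only: blinfun_apply_blinfun_compose)
  next
    have "N\<^sup>2 * (norm (QbT o\<^sub>L ST) + norm (Qb o\<^sub>L S) * T) * T * norm G * exp (2 * (N * norm G * \<beta> * T))
        = M\<^sup>2 * (C_QTST + C_QS * T) * T * C_BR * exp (2 * M * exp (\<omega> * T) * C_BR * \<beta> * T + 2 * \<omega> * T)"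
      unfolding \<open>N\<^sup>2 = _\<close> exp_add by (simp add: N_def G_def assms(18-20) mult_ac)
    then show "N\<^sup>2 * (norm (QbT o\<^sub>L ST) + norm (Qb o\<^sub>L S) * T) * T * norm G * exp (2 * (N * norm G * \<beta> * T)) < 1"
      using assms(23) by (simp only:)
  qed
  have "s1 t = s2 t" if t: "t \<in> {0..T}" for t
  proof -
    have "(LINT u:{t..T}|lborel. 1/2 * Tr (\<sigma> o\<^sub>L adj \<sigma> o\<^sub>L P1 u) - 1/2 * (G (r1 u) \<bullet> r1 u) + 1/2 * (Qb (S (z1 u)) \<bullet> S (z1 u)))
        = (LINT u:{t..T}|lborel. 1/2 * Tr (\<sigma> o\<^sub>L adj \<sigma> o\<^sub>L P2 u) - 1/2 * (G (r2 u) \<bullet> r2 u) + 1/2 * (Qb (S (z2 u)) \<bullet> S (z2 u)))"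
      using t by (intro set_lebesgue_integral_cong) (auto simp: Peq zr)
    moreover have "z1 T = z2 T" using zr[of T] T by simp
    moreover have "s1 t = 1/2 * (QbT (ST (z1 T)) \<bullet> ST (z1 T)) + (LINT u:{t..T}|lborel.
        1/2 * Tr (\<sigma> o\<^sub>L adj \<sigma> o\<^sub>L P1 u) - 1/2 * (G (r1 u) \<bullet> r1 u) + 1/2 * (Qb (S (z1 u)) \<bullet> S (z1 u)))"
      "s2 t = 1/2 * (QbT (ST (z2 T)) \<bullet> ST (z2 T)) + (LINT u:{t..T}|lborel.
        1/2 * Tr (\<sigma> o\<^sub>L adj \<sigma> o\<^sub>L P2 u) - 1/2 * (G (r2 u) \<bullet> r2 u) + 1/2 * (Qb (S (z2 u)) \<bullet> S (z2 u)))"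
      using sol1 sol2 t by blast+
    ultimately show ?thesis by simp
  qed
  then show ?thesis using Peq zr by blast
qed

end
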